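(* Let $G=\langle a,b\mid a^b=a^2\rangle$, let $\leq$ be a total order on $G$ such that $(G,\leq)$ is an ordered group, and let $S$ be a finite generating subset of $G$. Then the following statements hold. (i) If $|S|=k>4$, then $|S^2|=3|S|-2$ if and only if $S=\{x,xc,\dots,xc^{k-1}\}$ for some $x,c\in G$, where $c>1$ and either $c^x=c^2$ or $(c^2)^x=c$. (ii) If $|S|=4$, then $|S^2|=3|S|-2$ if and only if, for some $x,c\in G$, either $S=\{1,c,c^2,x\}$, where either $c^x=c^2$ or $(c^2)^x=c$, or $S=\{x,xc,xc^2,xc^3\}$, where $c>1$ and either $c^x=c^2$ or $(c^2)^x=c$.
   Context: Groups are written multiplicatively with identity $1$. An ordered group $(G,\leq)$ is a group $G$ with a total order $\leq$ on the set $G$ such that $a\leq b$ implies $xay\leq xby$ for all $a,b,x,y\in G$. (The group $G$ here is the Baumslag-Solitar group $BS(1,2)$, which is known to be orderable.) For a subset $S$ of $G$, $S^2=\{x_1x_2\mid x_1,x_2\in S\}$. Notation: $a^b=b^{-1}ab$. *)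

theory Defs
  imports "HOL-Algebra.Algebra"
begin

section \<open>Groups given by generators and relations\<close>

text \<open>
  The generating set is the whole type \<open>'x\<close>. A letter \<open>(True, x)\<close> stands for \<open>x\<close> and
  \<open>(False, x)\<close> for its inverse. A pair \<open>(l, r)\<close> in \<open>R\<close> stands for the defining relation \<open>l = r\<close>.
  Two words denote the same element of \<open>\<langle>'x | R\<rangle>\<close> iff they are related by the least congruence on
  words that contains free cancellation and the relations in \<open>R\<close>.
\<close>

type_synonym 'x gword = "(bool \<times> 'x) list"

inductive word_eq :: "('x gword \<times> 'x gword) set \<Rightarrow> 'x gword \<Rightarrow> 'x gword \<Rightarrow> bool"
  for R :: "('x gword \<times> 'x gword) set" where
  refl: "word_eq R u u"
| sym: "word_eq R u v \<Longrightarrow> word_eq R v u"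
| trans: "word_eq R u v \<Longrightarrow> word_eq R v w \<Longrightarrow> word_eq R u w"
| cancel: "word_eq R (u @ [(s, x), (\<not> s, x)] @ v) (u @ v)"
| relation: "(l, r) \<in> R \<Longrightarrow> word_eq R (u @ l @ v) (u @ r @ v)"

definition word_class :: "('x gword \<times> 'x gword) set \<Rightarrow> 'x gword \<Rightarrow> 'x gword set" where
  "word_class R u = {v. word_eq R u v}"

definition presented_group :: "('x gword \<times> 'x gword) set \<Rightarrow> 'x gword set monoid" where
  "presented_group R =
     \<lparr> carrier = range (word_class R),
       monoid.mult = (\<lambda>A B. \<Union>u\<in>A. \<Union>v\<in>B. word_class R (u @ v)),
       one = word_class R [] \<rparr>"

lemma word_eq_append_left: "word_eq R u v \<Longrightarrow> word_eq R (p @ u) (p @ v)"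
proof (induction rule: word_eq.induct)
  case (cancel u s x v)
  show ?case using word_eq.cancel[of R "p @ u" s x v] by simp
next
  case (relation l r u v)
  then show ?case using word_eq.relation[of l r R "p @ u" v] by simp
qed (blast intro: word_eq.intros)+

lemma word_eq_append_right: "word_eq R u v \<Longrightarrow> word_eq R (u @ p) (v @ p)"
proof (induction rule: word_eq.induct)
  case (cancel u s x v)
  show ?case using word_eq.cancel[of R u s x "v @ p"] by simp
next
  case (relation l r u v)
  then show ?case using word_eq.relation[of l r R u "v @ p"] by simp
qed (blast intro: word_eq.intros)+

lemma word_eq_append:
  "word_eq R u u' \<Longrightarrow> word_eq R v v' \<Longrightarrow> word_eq R (u @ v) (u' @ v')"
  by (meson word_eq.trans word_eq_append_left word_eq_append_right)

lemma word_class_eq_iff: "word_class R u = word_class R v \<longleftrightarrow> word_eq R u v"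
  unfolding word_class_def by (blast intro: word_eq.intros)

lemma presented_group_mult:
  "word_class R u \<otimes>\<^bsub>presented_group R\<^esub> word_class R v = word_class R (u @ v)"
  unfolding presented_group_def word_class_def
  by (auto intro: word_eq.trans word_eq_append word_eq.refl)

lemma presented_group_one: "\<one>\<^bsub>presented_group R\<^esub> = word_class R []"
  by (simp add: presented_group_def)

lemma presented_group_carrier: "carrier (presented_group R) = range (word_class R)"
  by (simp add: presented_group_def)

lemma word_eq_inverse: "word_eq R (rev (map (\<lambda>(s, x). (\<not> s, x)) u) @ u) []"
proof (induction u)
  case Nil
  show ?case by (simp add: word_eq.refl)
next
  case (Cons a u)
  obtain s x where a: "a = (s, x)" by (cases a)
  show ?case
    using word_eq.cancel[of R "rev (map (\<lambda>(s, x). (\<not> s, x)) u)" "\<not> s" x u] Cons.IH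
    by (auto simp: a intro: word_eq.trans)
qed

lemma group_presented_group: "group (presented_group R)"
proof (rule groupI)
  fix A assume "A \<in> carrier (presented_group R)"
  then obtain u where "A = word_class R u" by (auto simp: presented_group_carrier)
  then show "\<exists>B\<in>carrier (presented_group R). B \<otimes>\<^bsub>presented_group R\<^esub> A = \<one>\<^bsub>presented_group R\<^esub>"
    using word_eq_inverse[of R u]
    by (auto simp: presented_group_carrier presented_group_mult presented_group_one
        word_class_eq_iff)
qed (auto simp: presented_group_carrier presented_group_mult presented_group_one)


section \<open>The Baumslag-Solitar group \<open>BS(1,2) = \<langle>a, b | a\<^sup>b = a\<^sup>2\<rangle>\<close>\<close>

datatype bs_gen = Gen_a | Gen_b

text \<open>The relation is \<open>b\<inverse> a b = a a\<close>, since \<open>a\<^sup>b = b\<inverse> a b\<close>.\<close>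

definition BS_1_2 :: "bs_gen gword set monoid" where
  "BS_1_2 = presented_group
     {([(False, Gen_b), (True, Gen_a), (True, Gen_b)], [(True, Gen_a), (True, Gen_a)])}"


section \<open>Ordered groups\<close>

locale ordered_group = group G for G (structure) +
  fixes le :: "('a \<times> 'a) set"
  assumes linear_order: "linear_order_on (carrier G) le"
    and translate: "\<lbrakk> a \<in> carrier G; b \<in> carrier G; x \<in> carrier G; y \<in> carrier G; (a, b) \<in> le \<rbrakk>
      \<Longrightarrow> (x \<otimes> a \<otimes> y, x \<otimes> b \<otimes> y) \<in> le"

definition group_conj :: "('a, 'm) monoid_scheme \<Rightarrow> 'a \<Rightarrow> 'a \<Rightarrow> 'a" where
  "group_conj G c x = inv\<^bsub>G\<^esub> x \<otimes>\<^bsub>G\<^esub> c \<otimes>\<^bsub>G\<^esub> x"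

end

theory Submission
  imports Defs "HOL-Library.Set_Algebras"
begin

text \<open>
  The group \<open>BS(1,2)\<close> embeds into the group of affine maps \<open>t \<mapsto> 2\<^sup>e t + m\<close> of the real line, with \<open>e\<close> an
  integer, the height, and \<open>m\<close> real: \<open>a\<close> goes to \<open>t + 1\<close> and \<open>b\<close> to \<open>2 t\<close>. Comparing first the heights
  and then the translation parts orders this group in a two-sided invariant way, so all products can
  be counted there; the given order only decides between \<open>c\<close> and its inverse at the end. Write \<open>S\<^sup>2\<close>
  for the product set and \<open>k\<close> for the size of \<open>S\<close>.

  Let \<open>x\<close> be the largest element of \<open>S\<close> and \<open>T = S - {x}\<close>. Passing to inverses if necessary, \<open>x\<close> has
  nonzero height, and then its centraliser is abelian and has at most one element of each height.
  Hence few elements of \<open>T\<close> commute with \<open>x\<close>. If \<open>S\<close> is noncommuting and \<open>k \<ge> 3\<close>, multiplying \<open>T\<close> by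
  \<open>x\<close> on both sides produces at least three elements outside \<open>T\<^sup>2\<close>, and even four if \<open>S\<close> meets two
  heights (\<open>card_mult_insert_max\<close>). By induction, with the case of a commuting \<open>T\<close> as its basis,
  \<open>\<bar>S\<^sup>2\<bar> \<ge> 3 k - 2\<close> for every noncommuting \<open>S\<close> (\<open>card_mult_noncommuting_ge\<close>), and equality for a
  set \<open>S\<close> that meets two heights forces \<open>T\<close> to be commuting. A commuting set either consists of
  translations or lies in the centraliser of an element of nonzero height, and the second kind yields
  at least \<open>4 k - 5\<close> products, too many for \<open>k \<ge> 4\<close>. Thus \<open>S\<close> consists of translations by
  a set \<open>A\<close> of reals and of one further element \<open>x\<close> (\<open>small_doubling_two_heights\<close>).

  With \<open>q = 2\<^sup>e\<close>, where \<open>e\<close> is the height of \<open>x\<close>, this gives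
  \<open>\<bar>S\<^sup>2\<bar> = \<bar>A + A\<bar> + \<bar>A \<union> q A\<bar> + 1\<close>. Both sizes must be as small as possible: \<open>A\<close> is an arithmetic
  progression, and \<open>q A\<close> has only one element outside \<open>A\<close>. This leaves \<open>A = {0, d, 2 d}\<close> and
  \<open>q = 2\<close> or \<open>q = 1/2\<close>, the exceptional sets \<open>{1, c, c\<^sup>2, x}\<close> (\<open>image_dilate_invariants\<close>).

  If all elements of \<open>S\<close> have the same height \<open>e\<close>, then \<open>e = 1\<close> or \<open>e = -1\<close> because \<open>S\<close> generates, and
  \<open>\<bar>S\<^sup>2\<bar> = \<bar>2 A + A\<bar>\<close> for the set \<open>A\<close> of translation parts. This equals \<open>3 k - 2\<close> exactly
  for arithmetic progressions \<open>A\<close> (\<open>card_mult_one_ht_iff\<close>), and these correspond to the sets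
  \<open>{x, x c, \<dots>, x c\<^sup>k\<^sup>-\<^sup>1}\<close>.
\<close>

section \<open>Product sets in bi-ordered semigroups\<close>

class bi_ordered_semigroup = semigroup_mult + linorder +
  assumes mult_less_left: "a < b \<Longrightarrow> c * a < c * b"
    and mult_less_right: "a < b \<Longrightarrow> a * c < b * c"
begin

lemma mult_le_left: "a \<le> b \<Longrightarrow> c * a \<le> c * b"
  by (metis le_less mult_less_left)

lemma mult_le_right: "a \<le> b \<Longrightarrow> a * c \<le> b * c"
  by (metis le_less mult_less_right)

lemma left_cancel: "c * a = c * b \<longleftrightarrow> a = b"
  by (metis less_irrefl linorder_cases mult_less_left)

lemma right_cancel: "a * c = b * c \<longleftrightarrow> a = b"
  by (metis less_irrefl linorder_cases mult_less_right)

lemma mult_le_less: "a \<le> b \<Longrightarrow> c < d \<Longrightarrow> a * c < b * d"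
  by (metis le_less_trans mult_le_right mult_less_left)

lemma mult_less_le: "a < b \<Longrightarrow> c \<le> d \<Longrightarrow> a * c < b * d"
  by (metis less_le_trans mult_le_left mult_less_right)

end

definition pairwise_commuting :: "'a::times set \<Rightarrow> bool" where
  "pairwise_commuting S \<longleftrightarrow> (\<forall>x\<in>S. \<forall>y\<in>S. x * y = y * x)"

lemma finite_set_mult: "finite S \<Longrightarrow> finite (S * S :: 'a::times set)"
  by (rule finite_set_times)

lemma card_mult_gain:
  fixes S T N :: "'a::times set"
  assumes "finite S" "T \<subseteq> S" "N \<subseteq> S * S"
    and new: "\<And>p q. p \<in> T \<Longrightarrow> q \<in> T \<Longrightarrow> p * q \<notin> N"
  shows "card (T * T) + card N \<le> card (S * S)"
proof -
  have "T * T \<subseteq> S * S" using assms(2) by (rule set_times_mono2[OF _ assms(2)])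
  then have "card (T * T \<union> N) \<le> card (S * S)"
    using assms by (intro card_mono finite_set_mult) auto
  moreover have "card (T * T \<union> N) = card (T * T) + card N"
    using assms finite_subset[OF assms(2,1)]
    by (intro card_Un_disjoint)
      (auto intro: finite_set_mult finite_subset[OF assms(3)] elim!: set_times_elim)
  ultimately show ?thesis by simp
qed

text \<open>
  Adding a new largest element \<open>x\<close> to a set with maximum \<open>y\<close> creates the two products \<open>x y < x x\<close>,
  which exceed all earlier ones.
\<close>

lemma card_mult_self_ge:
  fixes S :: "'a::bi_ordered_semigroup set"
  assumes "finite S"
  shows "2 * card S \<le> card (S * S) + 1"
  using assms
proof (induction rule: finite_linorder_max_induct)
  case empty
  show ?case by simp
next
  case (insert x T)
  show ?case
  proof (cases "T = {}")
    case True
    then show ?thesis by (simp add: set_times_def)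
  next
    case False
    define y where "y = Max T"
    have y: "y \<in> T" "y < x" "\<And>t. t \<in> T \<Longrightarrow> t \<le> y"
      using insert False by (auto simp: y_def)
    have new: "p * q < x * y" if "p \<in> T" "q \<in> T" for p q
      using that y insert by (intro mult_less_le) auto
    have "x * y < x * x" using y(2) by (rule mult_less_left)
    then have "card (T * T) + card {x * y, x * x} \<le> card (insert x T * insert x T)"
    proof (intro card_mult_gain)
      show "p * q \<notin> {x * y, x * x}" if "p \<in> T" "q \<in> T" for p q
        using new[OF that] \<open>x * y < x * x\<close> by auto
    qed (use insert(1) y in \<open>auto intro: set_times_intro\<close>)
    moreover have "card {x * y, x * x} = 2" using \<open>x * y < x * x\<close> by auto
    ultimately show ?thesis using insert by auto
  qed
qed

text \<open>
  If \<open>x t\<close> were a product of two elements of the commuting set \<open>T\<close>, then everything in \<open>T\<close> would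
  commute with \<open>x t\<close> and, by cancellation, with \<open>x\<close>. So the products of \<open>T\<close> with \<open>x\<close> avoid \<open>T * T\<close>.
\<close>

lemma card_mult_insert_commuting:
  fixes T :: "'a::bi_ordered_semigroup set"
  assumes fin: "finite T" and com: "pairwise_commuting T" and max: "\<And>t. t \<in> T \<Longrightarrow> t < x"
    and s: "s \<in> T" "x * s \<noteq> s * x"
  shows "card (T * T) + card ((*) x ` T \<union> (\<lambda>t. t * x) ` T) + 1
      \<le> card (insert x T * insert x T)"
proof -
  let ?N = "(*) x ` T \<union> (\<lambda>t. t * x) ` T"
  have comT: "p * q = q * p" if "p \<in> T" "q \<in> T" for p q
    using com that by (auto simp: pairwise_commuting_def)
  have pqs: "p * q * s = s * (p * q)" if "p \<in> T" "q \<in> T" for p q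
  proof -
    have "p * q * s = p * s * q" using comT[OF that(2) s(1)] by (simp add: mult.assoc)
    also have "\<dots> = s * (p * q)" using comT[OF that(1) s(1)] by (simp add: mult.assoc)
    finally show ?thesis .
  qed
  have "x * t \<noteq> p * q" "t * x \<noteq> p * q" if "t \<in> T" "p \<in> T" "q \<in> T" for t p q
  proof -
    show "x * t \<noteq> p * q"
    proof
      assume eq: "x * t = p * q"
      have "(s * x) * t = s * (p * q)" by (simp add: eq mult.assoc)
      also have "\<dots> = (p * q) * s" by (rule pqs[OF that(2,3), symmetric])
      also have "\<dots> = x * (t * s)" by (simp add: eq[symmetric] mult.assoc)
      also have "\<dots> = (x * s) * t" using comT[OF s(1) that(1)] by (simp add: mult.assoc)
      finally show False using s(2) by (simp add: right_cancel)
    qed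
    show "t * x \<noteq> p * q"
    proof
      assume eq: "t * x = p * q"
      have "t * (x * s) = (p * q) * s" by (simp add: eq[symmetric] mult.assoc)
      also have "\<dots> = s * (p * q)" by (rule pqs[OF that(2,3)])
      also have "\<dots> = (s * t) * x" by (simp add: eq[symmetric] mult.assoc)
      also have "\<dots> = t * (s * x)" using comT[OF s(1) that(1)] by (simp add: mult.assoc)
      finally show False using s(2) by (simp add: left_cancel)
    qed
  qed
  moreover have "p * q < x * x" if "p \<in> T" "q \<in> T" for p q
    using max that by (intro mult_less_le less_imp_le)
  ultimately have "p * q \<notin> insert (x * x) ?N" if "p \<in> T" "q \<in> T" for p q
    using that by (metis (no_types, lifting) UnE imageE insertE less_irrefl)
  then have "card (T * T) + card (insert (x * x) ?N) \<le> card (insert x T * insert x T)"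
    using fin by (intro card_mult_gain) (auto intro: set_times_intro)
  moreover have "x * t < x * x" "t * x < x * x" if "t \<in> T" for t
    using max[OF that] by (auto intro: mult_less_left mult_less_right)
  then have "x * x \<notin> ?N" by fastforce
  then have "card (insert (x * x) ?N) = card ?N + 1"
    using fin by simp
  ultimately show ?thesis by simp
qed

text \<open>
  Left and right multiplication by \<open>x\<close> both preserve the order, so equal images of the finite set \<open>T\<close>
  would agree pointwise. To find the extra element it suffices to look at the largest \<open>z\<close> in \<open>T\<close> that
  does not commute with \<open>x\<close>: the larger of \<open>x z\<close> and \<open>z x\<close> belongs to only one of the two images.
\<close>

lemma card_translates_ge:
  fixes T :: "'a::bi_ordered_semigroup set"
  assumes fin: "finite T" and s: "s \<in> T" "x * s \<noteq> s * x"
  shows "card T + 1 \<le> card ((*) x ` T \<union> (\<lambda>t. t * x) ` T)"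
proof -
  define Z where "Z = {t \<in> T. x * t \<noteq> t * x}"
  define z where "z = Max Z"
  have Z: "finite Z" "Z \<noteq> {}" using fin s by (auto simp: Z_def)
  have z: "z \<in> T" "x * z \<noteq> z * x" using Max_in[OF Z] by (auto simp: z_def Z_def)
  have above: "x * t = t * x" if "t \<in> T" "z < t" for t
    using that Max_ge[OF Z(1), of t] unfolding z_def Z_def by (auto simp: not_less[symmetric])
  have cards: "card ((*) x ` T) = card T" "card ((\<lambda>t. t * x) ` T) = card T"
    by (auto intro!: card_image inj_onI simp: left_cancel right_cancel)
  consider "x * z \<notin> (\<lambda>t. t * x) ` T" | "z * x \<notin> (*) x ` T"
  proof (cases "z * x < x * z")
    case True
    have "x * z \<noteq> t * x" if "t \<in> T" for t
    proof
      assume eq: "x * z = t * x"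
      then have "z < t" using True by (metis mult_le_right not_le)
      then show False using above[OF that] eq left_cancel by (metis less_irrefl)
    qed
    then show ?thesis using that by auto
  next
    case False
    then have less: "x * z < z * x" using z by auto
    have "z * x \<noteq> x * t" if "t \<in> T" for t
    proof
      assume eq: "z * x = x * t"
      then have "z < t" using less by (metis mult_le_left not_le)
      then show False using above[OF that] eq right_cancel by (metis less_irrefl)
    qed
    then show ?thesis using that by auto
  qed
  then show ?thesis
  proof cases
    case 1
    have "card (insert (x * z) ((\<lambda>t. t * x) ` T)) \<le> card ((*) x ` T \<union> (\<lambda>t. t * x) ` T)"
      using fin z by (intro card_mono) auto
    then show ?thesis using 1 fin cards by auto
  next
    case 2
    have "card (insert (z * x) ((*) x ` T)) \<le> card ((*) x ` T \<union> (\<lambda>t. t * x) ` T)"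
      using fin z by (intro card_mono) auto
    then show ?thesis using 2 fin cards by auto
  qed
qed

section \<open>The affine group\<close>

text \<open>
  \<open>Aff e m\<close> is the affine map \<open>t \<mapsto> 2\<^sup>e t + m\<close>, and products are composed from left to right. The
  translation part may be any real number, whereas the image of \<open>BS(1,2)\<close> only contains dyadic
  rationals; this makes no difference for counting products.
\<close>

datatype aff = Aff (ht: int) (tr: real)

instantiation aff :: "{monoid_mult, linorder}"
begin

definition one_aff :: aff where "1 = Aff 0 0"

definition times_aff :: "aff \<Rightarrow> aff \<Rightarrow> aff" where
  "x * y = Aff (ht x + ht y) (2 powi ht y * tr x + tr y)"

definition less_aff :: "aff \<Rightarrow> aff \<Rightarrow> bool" where
  "x < y \<longleftrightarrow> ht x < ht y \<or> ht x = ht y \<and> tr x < tr y"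

definition less_eq_aff :: "aff \<Rightarrow> aff \<Rightarrow> bool" where
  "x \<le> y \<longleftrightarrow> ht x < ht y \<or> ht x = ht y \<and> tr x \<le> tr y"

instance
proof
  fix x y z :: aff
  show "x * y * z = x * (y * z)"
    by (simp add: times_aff_def power_int_add algebra_simps)
  show "1 * x = x" "x * 1 = x" by (simp_all add: times_aff_def one_aff_def)
  show "x < y \<longleftrightarrow> x \<le> y \<and> \<not> y \<le> x" "x \<le> x" "x \<le> y \<or> y \<le> x"
    by (auto simp: less_aff_def less_eq_aff_def)
  show "x \<le> z" if "x \<le> y" "y \<le> z" using that by (auto simp: less_eq_aff_def)
  show "x = y" if "x \<le> y" "y \<le> x" using that by (auto simp: less_eq_aff_def intro: aff.expand)
qed

end

instance aff :: bi_ordered_semigroup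
proof
  fix x y z :: aff
  assume "x < y"
  then show "z * x < z * y" "x * z < y * z"
    by (auto simp: less_aff_def times_aff_def)
qed

lemma ht_mult [simp]: "ht (x * y) = ht x + ht y"
  by (simp add: times_aff_def)

lemma ht_one [simp]: "ht 1 = 0"
  by (simp add: one_aff_def)

lemma commute_iff: "x * y = y * x \<longleftrightarrow> (2 powi ht y - 1) * tr x = (2 powi ht x - 1) * tr y"
  by (simp add: times_aff_def algebra_simps)

lemma two_powi_eq_1_iff [simp]: "(2::real) powi e = 1 \<longleftrightarrow> e = 0"
  using power_int_strict_increasing[of 0 e "2::real"] power_int_strict_increasing[of e 0 "2::real"]
  by (cases e "0::int" rule: linorder_cases) auto

lemma commute_mult:
  fixes x y z :: "'a::semigroup_mult"
  assumes "x * y = y * x" "x * z = z * x"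
  shows "x * (y * z) = y * z * x"
proof -
  have "x * (y * z) = y * (x * z)" using assms(1) by (simp flip: mult.assoc)
  then show ?thesis using assms(2) by (simp add: mult.assoc)
qed

text \<open>
  By \<open>commute_iff\<close>, the height of an element commuting with \<open>x\<close> determines its translation part when
  \<open>x\<close> has nonzero height. Geometrically, such an \<open>x\<close> has a unique fixed point, every element commuting
  with \<open>x\<close> shares this fixed point, and an affine map is determined by its slope and one value.
\<close>

lemma commute_same_ht:
  assumes "ht x \<noteq> 0" "x * y = y * x" "x * z = z * x" "ht y = ht z"
  shows "y = z"
proof -
  have "(2 powi ht x - 1) * tr y = (2 powi ht x - 1) * tr z"
    using assms by (metis commute_iff)
  then show ?thesis using assms by (auto intro: aff.expand)
qed

lemma commute_trans:
  assumes "ht x \<noteq> 0" "x * y = y * x" "x * z = z * x"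
  shows "y * z = z * y"
proof (rule commute_same_ht[OF assms(1)])
  show "x * (y * z) = y * z * x" "x * (z * y) = z * y * x" using assms by (auto intro: commute_mult)
qed simp

text \<open>
  If \<open>y\<close> has nonzero height, then \<open>x\<close> and \<open>y\<close> both lie in the abelian centraliser of
  \<open>y * y\<close>; if \<open>y\<close> is a translation, then so is \<open>y * y\<close>, and the only translation
  commuting with \<open>x\<close> is the identity.
\<close>

lemma commute_square:
  assumes "ht x \<noteq> 0" "x * (y * y) = y * y * x"
  shows "x * y = y * x"
proof (cases "ht y = 0")
  case True
  then show ?thesis
    using assms by (auto simp: commute_iff) (auto simp: times_aff_def)
next
  case False
  then have "ht (y * y) \<noteq> 0" by simp
  from commute_trans[OF this, of x y] show ?thesis using assms by (simp add: mult.assoc)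
qed

lemma commuting_if_commute:
  assumes "ht x \<noteq> 0" "\<And>t. t \<in> S \<Longrightarrow> x * t = t * x"
  shows "pairwise_commuting S"
  unfolding pairwise_commuting_def using assms commute_trans by blast

section \<open>New products with the largest element\<close>

lemma ht_mono: "x \<le> y \<Longrightarrow> ht x \<le> ht (y::aff)"
  by (auto simp: less_eq_aff_def)

text \<open>
  The second largest element \<open>y\<close> cannot commute with \<open>x\<close>, so \<open>x x\<close>, \<open>x y\<close> and \<open>y x\<close> are new. The
  fourth new product comes from the largest element \<open>w\<close> of smaller height: among the products of the
  same height, the larger of \<open>x w\<close> and \<open>w x\<close> exceeds all those that avoid \<open>x\<close>.
\<close>

lemma card_mult_gain_same_ht:
  fixes x :: aff
  assumes fin: "finite T" and max: "\<And>t. t \<in> T \<Longrightarrow> t < x" and x: "ht x \<noteq> 0"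
    and y: "y \<in> T" "ht y = ht x" "\<And>t. t \<in> T \<Longrightarrow> t \<le> y"
  shows "card (T * T) + 3 \<le> card (insert x T * insert x T)"
    and "\<exists>t\<in>T. ht t \<noteq> ht x \<Longrightarrow> card (T * T) + 4 \<le> card (insert x T * insert x T)"
proof -
  have yx: "y < x" using max y by auto
  have nc: "x * y \<noteq> y * x" using commute_same_ht[OF x, of y x] y yx by auto
  have less: "x * y < x * x" "y * x < x * x" using yx by (auto intro: mult_less_left mult_less_right)
  have new: "p * q < x * y" "p * q < y * x" if "p \<in> T" "q \<in> T" for p q
    using that max y by (auto intro: mult_less_le mult_le_less)
  have new': "p * q \<notin> {x * x, x * y, y * x}" if "p \<in> T" "q \<in> T" for p q
    using new[OF that] less by auto
  then have "card (T * T) + card {x * x, x * y, y * x} \<le> card (insert x T * insert x T)"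
    using fin y by (intro card_mult_gain) (auto intro: set_times_intro)
  moreover have three: "card {x * x, x * y, y * x} = 3"
  proof -
    have "x * x \<noteq> x * y" "x * x \<noteq> y * x" using less by auto
    then show ?thesis using nc by simp
  qed
  ultimately show "card (T * T) + 3 \<le> card (insert x T * insert x T)" by simp
  assume "\<exists>t\<in>T. ht t \<noteq> ht x"
  define W where "W = {t \<in> T. ht t \<noteq> ht x}"
  define w where "w = Max W"
  have W: "finite W" "W \<noteq> {}" using fin \<open>\<exists>t\<in>T. _\<close> by (auto simp: W_def)
  have "w \<in> W" unfolding w_def using W by (rule Max_in)
  have w: "w \<in> T" "ht w < ht x"
    using \<open>w \<in> W\<close> max[of w] ht_mono[of w x] by (auto simp: W_def)
  have wmax: "t \<le> w" if "t \<in> T" "ht t \<noteq> ht x" for t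
    unfolding w_def using that W by (intro Max_ge) (auto simp: W_def)
  define v where "v = max (x * w) (w * x)"
  have v: "v \<in> {x * w, w * x}" by (auto simp: v_def max_def)
  have "p * q < v" if "p \<in> T" "q \<in> T" "ht (p * q) = ht v" for p q
  proof (cases "ht p = ht x")
    case True
    then have "ht q \<noteq> ht x" using that(3) v w by auto
    then have "p * q < x * w" using that max wmax by (intro mult_less_le) auto
    then show ?thesis by (simp add: v_def less_max_iff_disj)
  next
    case False
    then have "p * q < w * x" using that max wmax by (intro mult_le_less) auto
    then show ?thesis by (simp add: v_def less_max_iff_disj)
  qed
  then have "p * q \<noteq> v" if "p \<in> T" "q \<in> T" for p q using that by (metis less_irrefl)
  then have "card (T * T) + card {v, x * x, x * y, y * x} \<le> card (insert x T * insert x T)"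
    using fin y w v new'
    by (intro card_mult_gain) (auto intro: set_times_intro)
  moreover have "ht v < ht (x * x)" "ht v < ht (x * y)" "ht v < ht (y * x)" using v w y by auto
  then have "v \<notin> {x * x, x * y, y * x}" by auto
  then have "card {v, x * x, x * y, y * x} = 4" using three by simp
  ultimately show "card (T * T) + 4 \<le> card (insert x T * insert x T)" by simp
qed

text \<open>
  Here \<open>x\<close> is alone at the top height, so every product whose height is that of \<open>x y\<close> is new. If another
  element \<open>y'\<close> has the height of \<open>y\<close>, the products of \<open>x\<close> with \<open>y\<close> and \<open>y'\<close> give three of this kind.
  Otherwise \<open>y\<close> is alone at its height. If \<open>x\<close> and \<open>y\<close> do not commute, a further product is found at
  the height of \<open>x z\<close> for the next smaller element \<open>z\<close>, where \<open>T * T\<close> contains at most \<open>y y\<close>.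
  If they commute, let \<open>z\<close> be the largest element not commuting with \<open>x\<close>: the elements of \<open>T * T\<close> at the height of \<open>x z\<close> are products of elements above \<open>z\<close>
  and hence commute with \<open>x\<close>, while \<open>x z\<close> and \<open>z x\<close> do not.
\<close>

lemma card_mult_gain_lower_ht:
  fixes x :: aff
  assumes fin: "finite T" and x: "ht x \<noteq> 0" and nc: "\<not> pairwise_commuting (insert x T)"
    and y: "y \<in> T" "ht y < ht x" "\<And>t. t \<in> T \<Longrightarrow> t \<le> y" and card: "2 \<le> card T"
  shows "card (T * T) + 4 \<le> card (insert x T * insert x T)"
proof -
  have ht_le: "ht t \<le> ht y" if "t \<in> T" for t using y(3)[OF that] by (rule ht_mono)
  have suff: ?thesis if "N \<subseteq> insert x T * insert x T" "card N = 4"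
      "\<And>p q. p \<in> T \<Longrightarrow> q \<in> T \<Longrightarrow> p * q \<notin> N" for N
    using card_mult_gain[of "insert x T" T N] that fin by auto
  have suff3: ?thesis
    if "N \<subseteq> insert x T * insert x T" "card N = 3" "\<And>v. v \<in> N \<Longrightarrow> ht v < ht (x * x)"
      "\<And>p q. p \<in> T \<Longrightarrow> q \<in> T \<Longrightarrow> p * q \<notin> N" for N
  proof (rule suff[of "insert (x * x) N"])
    have "finite N" using that(2) by (metis card.infinite zero_neq_numeral)
    moreover have "x * x \<notin> N" using that(3) by blast
    ultimately show "card (insert (x * x) N) = 4" using that(2) by simp
    show "p * q \<notin> insert (x * x) N" if "p \<in> T" "q \<in> T" for p q
    proof -
      have "ht (p * q) < ht (x * x)" using that ht_le[of p] ht_le[of q] y by simp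
      then have "p * q \<noteq> x * x" by (metis less_irrefl)
      then show ?thesis using that \<open>\<And>p q. p \<in> T \<Longrightarrow> q \<in> T \<Longrightarrow> p * q \<notin> N\<close> by auto
    qed
  qed (use that(1) in \<open>auto intro: set_times_intro\<close>)
  have high: "p * q \<noteq> z" if "p \<in> T" "q \<in> T" "ht z = ht x + ht y" for p q z
    using that ht_le[of p] ht_le[of q] y by auto
  show ?thesis
  proof (cases "\<exists>y'\<in>T. y' \<noteq> y \<and> ht y' = ht y")
    case True
    then obtain y' where y': "y' \<in> T" "y' \<noteq> y" "ht y' = ht y" by blast
    have "y' < y" using y(3)[OF y'(1)] y'(2) by simp
    then have less: "x * y' < x * y" "y' * x < y * x"
      by (auto intro: mult_less_left mult_less_right)
    \<comment> \<open>Below the smaller of \<open>x y\<close> and \<open>y x\<close> lies the corresponding product with \<open>y'\<close>; if both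
      coincide, then \<open>y'\<close> does not commute with \<open>x\<close> and contributes two smaller products.\<close>
    define N where "N = (if x * y < y * x then {x * y', x * y, y * x}
      else if y * x < x * y then {y' * x, y * x, x * y} else {x * y', y' * x, x * y})"
    have "x * y = y * x \<Longrightarrow> x * y' \<noteq> y' * x"
      using commute_same_ht[OF x, of y y'] y' by auto
    then have "card N = 3"
      using less order.strict_trans[of "x * y'" "x * y" "y * x"]
        order.strict_trans[of "y' * x" "y * x" "x * y"]
      by (cases "x * y" "y * x" rule: linorder_cases) (auto simp: N_def card_insert_if)
    then show ?thesis
    proof (rule suff3[rotated])
      show "N \<subseteq> insert x T * insert x T" using y y' by (auto simp: N_def intro: set_times_intro)
      show "p * q \<notin> N" if "p \<in> T" "q \<in> T" for p q
        using high[OF that] y' by (auto simp: N_def)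
    qed (use y y' in \<open>auto simp: N_def split: if_splits\<close>)
  next
    case False
    then have lower: "ht t < ht y" if "t \<in> T" "t \<noteq> y" for t
      using ht_le[OF that(1)] that by force
    show ?thesis
    proof (cases "x * y = y * x")
      case True
      define Z where "Z = {t \<in> T. x * t \<noteq> t * x}"
      define z where "z = Max Z"
      have "Z \<noteq> {}"
      proof
        assume "Z = {}"
        then have "pairwise_commuting (insert x T)" by (intro commuting_if_commute[OF x]) (auto simp: Z_def)
        then show False using nc by simp
      qed
      then have "z \<in> Z" using fin unfolding z_def by (intro Max_in) (auto simp: Z_def)
      then have z: "z \<in> T" "x * z \<noteq> z * x" "ht z < ht y"
        using lower[of z] True by (auto simp: Z_def)
      have zmax: "x * t = t * x" if "t \<in> T" "ht z < ht t" for t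
      proof (rule ccontr)
        assume "x * t \<noteq> t * x"
        then have "t \<le> z" unfolding z_def using that fin by (intro Max_ge) (auto simp: Z_def)
        then show False using ht_mono that(2) by force
      qed
      have new: "p * q \<notin> {x * z, z * x}" if p: "p \<in> T" and q: "q \<in> T" for p q
      proof
        assume pq: "p * q \<in> {x * z, z * x}"
        moreover have "ht (x * z) = ht x + ht z" "ht (z * x) = ht x + ht z" by simp_all
        ultimately have "ht (p * q) = ht x + ht z" by (metis insertE singletonD)
        then have "ht p + ht q = ht x + ht z" by simp
        then have "ht z < ht p" "ht z < ht q" using ht_le[OF p] ht_le[OF q] y(2) by auto
        then have "x * p = p * x" "x * q = q * x" using zmax p q by auto
        then have "x * (p * q) = p * q * x" by (rule commute_mult)
        then have "x * (x * z) = x * z * x \<or> x * (z * x) = z * x * x" using pq by auto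
        then have "x * (x * z) = x * (z * x) \<or> (x * z) * x = (z * x) * x"
          by (simp add: mult.assoc)
        then show False using z(2) by (auto simp only: left_cancel right_cancel)
      qed
      have "card {x * y, x * z, z * x} = 3"
      proof -
        have "ht (x * z) \<noteq> ht (x * y)" "ht (z * x) \<noteq> ht (x * y)" using z by auto
        then show ?thesis using z(2) by (metis card_3_iff)
      qed
      then show ?thesis
      proof (rule suff3[rotated])
        show "p * q \<notin> {x * y, x * z, z * x}" if "p \<in> T" "q \<in> T" for p q
          using new[OF that] high[OF that] by auto
      qed (use y z in \<open>auto intro: set_times_intro\<close>)
    next
      case ncy: False
      define z where "z = Max (T - {y})"
      have "T - {y} \<noteq> {}"
        using card card_mono[of "{y}" T] by auto
      then have "z \<in> T - {y}" using fin unfolding z_def by (intro Max_in) auto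
      then have z: "z \<in> T" "ht z < ht y" using lower by auto
      have zmax: "ht t \<le> ht z" if "t \<in> T" "t \<noteq> y" for t
        unfolding z_def using that fin by (intro ht_mono Max_ge) auto
      have only: "p * q = y * y" if p: "p \<in> T" and q: "q \<in> T" and h: "ht (p * q) = ht x + ht z" for p q
        using zmax[OF p] zmax[OF q] ht_le[OF p] ht_le[OF q] h y(2) by (cases "p = y"; cases "q = y") auto
      \<comment> \<open>Otherwise \<open>x\<close> commutes with \<open>z\<close>, hence with \<open>y y = x z\<close>, hence with \<open>y\<close>.\<close>
      have "x * z \<noteq> y * y \<or> z * x \<noteq> y * y"
      proof (rule ccontr)
        assume "\<not> ?thesis"
        then have eq: "x * z = y * y" "z * x = y * y" by auto
        then have "x * (y * y) = y * y * x" by (metis mult.assoc)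
        then show False using commute_square[OF x] ncy by blast
      qed
      then obtain v where v: "v \<in> {x * z, z * x}" "v \<noteq> y * y" by auto
      have "card {x * y, y * x, v} = 3"
      proof -
        have "ht v \<noteq> ht (x * y)" "ht v \<noteq> ht (y * x)" using v z by auto
        then show ?thesis using ncy by (metis card_3_iff)
      qed
      then show ?thesis
      proof (rule suff3[rotated])
        have "ht v = ht x + ht z" using v by auto
        then have "p * q \<noteq> v" if "p \<in> T" "q \<in> T" for p q
          using only[OF that] v(2) by metis
        then show "p * q \<notin> {x * y, y * x, v}" if "p \<in> T" "q \<in> T" for p q
          using that high[OF that] by auto
      qed (use y z v in \<open>auto intro: set_times_intro\<close>)
    qed
  qed
qed

section \<open>Noncommuting sets of affine maps\<close>

definition aff_inv :: "aff \<Rightarrow> aff" where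
  "aff_inv x = Aff (- ht x) (- tr x / 2 powi ht x)"

lemma ht_aff_inv [simp]: "ht (aff_inv x) = - ht x"
  by (simp add: aff_inv_def)

lemma aff_inv_mult: "aff_inv (x * y) = aff_inv y * aff_inv x"
  by (simp add: aff_inv_def times_aff_def power_int_add power_int_minus field_simps)

lemma aff_inv_left [simp]: "aff_inv x * x = 1"
  by (simp add: aff_inv_def times_aff_def one_aff_def)

lemma aff_inv_right [simp]: "x * aff_inv x = 1"
  by (simp add: aff_inv_def times_aff_def one_aff_def power_int_minus field_simps)

lemma inj_aff_inv: "inj_on aff_inv S"
  by (rule inj_onI) (metis aff_inv_left aff_inv_right left_cancel)

lemma card_aff_inv: "card (aff_inv ` S) = card S"
  by (rule card_image[OF inj_aff_inv])

lemma aff_inv_set_mult: "aff_inv ` S * aff_inv ` S = aff_inv ` (S * S)"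
  by (auto simp: set_times_def image_iff aff_inv_mult[symmetric])

lemma commuting_aff_inv: "pairwise_commuting (aff_inv ` S) \<longleftrightarrow> pairwise_commuting S"
proof -
  have "aff_inv x * aff_inv y = aff_inv y * aff_inv x \<longleftrightarrow> x * y = y * x" for x y
    using inj_onD[OF inj_aff_inv[of UNIV], of "y * x" "x * y"] by (auto simp flip: aff_inv_mult)
  then show ?thesis by (simp add: pairwise_commuting_def)
qed

lemma commuting_ht_zero: "(\<And>x. x \<in> S \<Longrightarrow> ht x = 0) \<Longrightarrow> pairwise_commuting S"
  by (auto simp: pairwise_commuting_def commute_iff)

text \<open>
  A noncommuting set contains an element of nonzero height. If this height is positive, so is that of
  the maximum; if it is negative, inversion, which reverses products and heights, makes it positive.
\<close>

lemma aff_wlog_max_ht [consumes 2, case_names inverse max]: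
  assumes "finite S" "\<not> pairwise_commuting S"
    and inv: "\<And>S. P (aff_inv ` S) \<Longrightarrow> P S"
    and max: "\<And>S x. \<lbrakk>finite S; \<not> pairwise_commuting S; x \<in> S; ht x \<noteq> 0; \<And>t. t \<in> S \<Longrightarrow> t \<le> x\<rbrakk> \<Longrightarrow> P S"
  shows "P S"
proof -
  have *: "P R" if R: "finite R" "\<not> pairwise_commuting R" "s \<in> R" "0 < ht s" for R s
  proof (rule max[OF R(1,2)])
    show "Max R \<in> R" using R by (intro Max_in) auto
    show "t \<le> Max R" if "t \<in> R" for t using R that by simp
    then show "ht (Max R) \<noteq> 0" using R ht_mono[of s "Max R"] by force
  qed
  obtain s where s: "s \<in> S" "ht s \<noteq> 0" using assms(2) commuting_ht_zero by blast
  show ?thesis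
  proof (cases "0 < ht s")
    case True
    show ?thesis using assms(1,2) s(1) True by (rule *)
  next
    case False
    have "P (aff_inv ` S)"
    proof (rule *)
      show "finite (aff_inv ` S)" "\<not> pairwise_commuting (aff_inv ` S)" "aff_inv s \<in> aff_inv ` S"
        using assms(1,2) s by (simp_all add: commuting_aff_inv)
      show "0 < ht (aff_inv s)" using s False by simp
    qed
    then show ?thesis by (rule inv)
  qed
qed

lemma card_mult_insert_max:
  fixes x :: aff
  assumes fin: "finite T" and max: "\<And>t. t \<in> T \<Longrightarrow> t < x" and x: "ht x \<noteq> 0"
    and nc: "\<not> pairwise_commuting (insert x T)" and card: "2 \<le> card T"
  shows "card (T * T) + 3 \<le> card (insert x T * insert x T)"
    and "\<exists>t\<in>T. ht t \<noteq> ht x \<Longrightarrow> card (T * T) + 4 \<le> card (insert x T * insert x T)"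
proof -
  define y where "y = Max T"
  have ne: "T \<noteq> {}" using card by auto
  have y: "y \<in> T" unfolding y_def using fin ne by (rule Max_in)
  have le: "t \<le> y" if "t \<in> T" for t unfolding y_def using fin that by (rule Max_ge)
  have low: "card (T * T) + 4 \<le> card (insert x T * insert x T)" if "ht y \<noteq> ht x"
  proof (rule card_mult_gain_lower_ht[OF fin x nc y _ le card])
    show "ht y < ht x" using that ht_mono[of y x] max[OF y] by auto
  qed
  show "card (T * T) + 3 \<le> card (insert x T * insert x T)"
  proof (cases "ht y = ht x")
    case True
    show ?thesis by (rule card_mult_gain_same_ht(1)[OF fin max x y True le])
  qed (use low in simp)
  show "card (T * T) + 4 \<le> card (insert x T * insert x T)" if "\<exists>t\<in>T. ht t \<noteq> ht x"
  proof (cases "ht y = ht x")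
    case True
    show ?thesis by (rule card_mult_gain_same_ht(2)[OF fin max x y True le that])
  qed (rule low)
qed

lemma card_mult_noncommuting_ge:
  fixes S :: "aff set"
  assumes "finite S" "\<not> pairwise_commuting S"
  shows "3 * card S \<le> card (S * S) + 2"
  using assms
proof (induction "card S" arbitrary: S rule: less_induct)
  case less
  show ?case
    using less.prems less.hyps
  proof (induction S rule: aff_wlog_max_ht)
    case (inverse S)
    then show ?case by (simp add: card_aff_inv aff_inv_set_mult)
  next
    case (max R x)
    note R = max(1,2) and x = max(3,4,5)
    define T where "T = R - {x}"
    have T: "finite T" "R = insert x T" "x \<notin> T" "\<And>t. t \<in> T \<Longrightarrow> t < x"
      using R x by (auto simp: T_def less_le)
    obtain s where s: "s \<in> T" "x * s \<noteq> s * x"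
      using R(2) commuting_if_commute[OF x(2), of R] T(2) by auto
    show "3 * card R \<le> card (R * R) + 2"
    proof (cases "pairwise_commuting T")
      case True
      show ?thesis
        using card_mult_insert_commuting[OF T(1) True T(4) s] card_translates_ge[OF T(1) s]
          card_mult_self_ge[OF T(1)] T by simp
    next
      case False
      then have IH: "3 * card T \<le> card (T * T) + 2"
        using T by (intro max(6)) auto
      have c2: "2 \<le> card T"
      proof (rule ccontr)
        assume "\<not> ?thesis"
        then have "pairwise_commuting T"
          using card_le_Suc0_iff_eq[OF T(1)] by (auto simp: pairwise_commuting_def)
        then show False using False by simp
      qed
      have "card (T * T) + 3 \<le> card (R * R)"
        unfolding T(2) by (rule card_mult_insert_max(1)[OF T(1,4) x(2) R(2)[unfolded T(2)] c2])
      then show ?thesis using IH T by simp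
    qed
  qed
qed

text \<open>
  All elements of \<open>T\<close> lie in the centraliser of \<open>g\<close>, so \<open>x t = t' x\<close> with \<open>t\<close> and \<open>t'\<close> in \<open>T\<close> forces
  \<open>t = t'\<close> by comparing heights. Then \<open>t\<close> commutes with \<open>x\<close> and with \<open>s\<close>, which do not commute with each
  other, so \<open>t\<close> has height 0; as it also commutes with \<open>g\<close>, it is the identity. The left and right translates of \<open>T\<close> by \<open>x\<close> are thus almost disjoint.
\<close>

lemma card_mult_insert_cyclic:
  fixes x :: aff
  assumes fin: "finite T" and com: "pairwise_commuting T" and max: "\<And>t. t \<in> T \<Longrightarrow> t < x"
    and x: "ht x \<noteq> 0" and s: "s \<in> T" "x * s \<noteq> s * x" and g: "g \<in> T" "ht g \<noteq> 0"
  shows "4 * card T \<le> card (insert x T * insert x T) + 1"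
proof -
  have comg: "g * t = t * g" if "t \<in> T" for t using com that g by (auto simp: pairwise_commuting_def)
  have "(*) x ` T \<inter> (\<lambda>t. t * x) ` T \<subseteq> {x}"
  proof
    fix v assume "v \<in> (*) x ` T \<inter> (\<lambda>t. t * x) ` T"
    then obtain t t' where t: "t \<in> T" "t' \<in> T" "v = x * t" "v = t' * x" by auto
    then have "ht t = ht t'" using ht_mult[of x t] ht_mult[of t' x] by simp
    then have "t = t'" using commute_same_ht[OF g(2) comg[OF t(1)] comg[OF t(2)]] by simp
    then have tx: "t * x = x * t" using t by simp
    have "ht t = 0"
    proof (rule ccontr)
      assume "ht t \<noteq> 0"
      moreover have "t * s = s * t" using com t s by (auto simp: pairwise_commuting_def)
      ultimately show False using commute_trans[of t x s] tx s(2) by simp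
    qed
    then have "t = 1" using comg[OF t(1)] commute_same_ht[OF g(2), of t 1] by simp
    then show "v \<in> {x}" using t by simp
  qed
  then have "card ((*) x ` T \<inter> (\<lambda>t. t * x) ` T) \<le> 1"
    using card_mono[of "{x}"] by fastforce
  moreover have "card ((*) x ` T) = card T" "card ((\<lambda>t. t * x) ` T) = card T"
    by (auto intro!: card_image inj_onI simp: left_cancel right_cancel)
  ultimately have "2 * card T \<le> card ((*) x ` T \<union> (\<lambda>t. t * x) ` T) + 1"
    using card_Un_Int[of "(*) x ` T" "(\<lambda>t. t * x) ` T"] fin by simp
  then show ?thesis
    using card_mult_insert_commuting[OF fin com max s] card_mult_self_ge[OF fin] by simp
qed

text \<open>
  If the maximum \<open>x\<close> has nonzero height and \<open>T = S - {x}\<close>, then \<open>S * S\<close> has at least four elements more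
  than \<open>T * T\<close>. For a noncommuting \<open>T\<close>, the bound \<open>card_mult_noncommuting_ge\<close> would give one product too
  many. So \<open>T\<close> is commuting, and \<open>card_mult_insert_cyclic\<close> excludes elements of nonzero height in \<open>T\<close>.
\<close>

lemma small_doubling_two_heights:
  fixes S :: "aff set"
  assumes "finite S" "\<not> pairwise_commuting S" "4 \<le> card S" "card (S * S) + 2 \<le> 3 * card S"
    and "\<exists>s\<in>S. \<exists>t\<in>S. ht s \<noteq> ht t"
  shows "\<exists>x\<in>S. ht x \<noteq> 0 \<and> (\<forall>t\<in>S - {x}. ht t = 0)"
  using assms
proof (induction S rule: aff_wlog_max_ht)
  case (inverse R)
  have "\<exists>s\<in>aff_inv ` R. \<exists>t\<in>aff_inv ` R. ht s \<noteq> ht t" using inverse(4) by auto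
  then have "\<exists>x\<in>aff_inv ` R. ht x \<noteq> 0 \<and> (\<forall>t\<in>aff_inv ` R - {x}. ht t = 0)"
    using inverse(2,3) by (intro inverse(1)) (simp_all add: card_aff_inv aff_inv_set_mult)
  then obtain x where x: "x \<in> R" "ht (aff_inv x) \<noteq> 0"
    "\<forall>t\<in>aff_inv ` R - {aff_inv x}. ht t = 0" by blast
  have "ht t = 0" if t: "t \<in> R - {x}" for t
  proof -
    have "aff_inv t \<noteq> aff_inv x" using t inj_onD[OF inj_aff_inv[of UNIV], of t x] by auto
    then have "ht (aff_inv t) = 0" using x(3) t by blast
    then show ?thesis by simp
  qed
  then show ?case using x(1,2) by (intro bexI[of _ x]) auto
next
  case (max R x)
  note R = max(1,2) and x = max(3,4,5)
  define T where "T = R - {x}"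
  have T: "finite T" "R = insert x T" "x \<notin> T" "\<And>t. t \<in> T \<Longrightarrow> t < x"
    using R x by (auto simp: T_def less_le)
  obtain s where s: "s \<in> T" "x * s \<noteq> s * x"
    using R(2) commuting_if_commute[OF x(2), of R] T(2) by auto
  have cT: "3 \<le> card T" using max(6) T by simp
  have two: "\<exists>t\<in>T. ht t \<noteq> ht x" using max(8) T(2) by (metis insert_iff)
  have c2: "2 \<le> card T" using cT by simp
  have "card (T * T) + 4 \<le> card (R * R)"
    unfolding T(2) by (rule card_mult_insert_max(2)[OF T(1,4) x(2) R(2)[unfolded T(2)] c2 two])
  then have "pairwise_commuting T" using card_mult_noncommuting_ge[OF T(1)] max(7) T by fastforce
  then have "ht t = 0" if "t \<in> T" for t
    using card_mult_insert_cyclic[OF T(1) _ T(4) x(2) s that] max(7) T cT by fastforce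
  then show ?case using x T_def by blast
qed

section \<open>Sums of dilates of finite sets of reals\<close>

definition dilate_sum :: "real \<Rightarrow> real set \<Rightarrow> real set" where
  "dilate_sum q A = (\<lambda>(a, b). q * a + b) ` (A \<times> A)"

definition progression :: "real \<Rightarrow> real \<Rightarrow> nat \<Rightarrow> real set" where
  "progression u d n = (\<lambda>i. u + real i * d) ` {..<n}"

lemma dilate_sumI: "a \<in> A \<Longrightarrow> b \<in> A \<Longrightarrow> q * a + b \<in> dilate_sum q A"
  unfolding dilate_sum_def by force

lemma dilate_sumE:
  assumes "v \<in> dilate_sum q A"
  obtains a b where "a \<in> A" "b \<in> A" "v = q * a + b"
  using assms unfolding dilate_sum_def by auto

lemma finite_dilate_sum: "finite A \<Longrightarrow> finite (dilate_sum q A)"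
  by (simp add: dilate_sum_def)

lemma progressionI: "i < n \<Longrightarrow> u + real i * d \<in> progression u d n"
  by (auto simp: progression_def)

lemma card_progression: "d \<noteq> 0 \<Longrightarrow> card (progression u d n) = n"
  unfolding progression_def by (subst card_image) (auto simp: inj_on_def)

lemma insert_progression: "insert (u + real n * d) (progression u d n) = progression u d (Suc n)"
  by (simp add: progression_def lessThan_Suc)

lemma dilate_sum_progression:
  assumes "0 < q" "q \<le> n"
  shows "dilate_sum (real q) (progression u d n)
    = progression ((real q + 1) * u) d (Suc (q * (n - 1) + (n - 1)))"
proof (intro equalityI subsetI)
  fix v assume "v \<in> dilate_sum (real q) (progression u d n)"
  then obtain i j where ij: "i < n" "j < n"
    and v: "v = real q * (u + real i * d) + (u + real j * d)"
    by (auto simp: dilate_sum_def progression_def)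
  have "q * i + j \<le> q * (n - 1) + (n - 1)" using ij by (intro add_mono mult_le_mono) auto
  moreover have "v = (real q + 1) * u + real (q * i + j) * d" by (simp add: v algebra_simps)
  ultimately show "v \<in> progression ((real q + 1) * u) d (Suc (q * (n - 1) + (n - 1)))"
    unfolding progression_def by (intro image_eqI[of _ _ "q * i + j"]) simp_all
next
  fix v assume "v \<in> progression ((real q + 1) * u) d (Suc (q * (n - 1) + (n - 1)))"
  then obtain m where m: "m \<le> q * (n - 1) + (n - 1)" and v: "v = (real q + 1) * u + real m * d"
    unfolding progression_def lessThan_Suc_atMost by blast
  \<comment> \<open>Write \<open>m = q i + j\<close> with remainder \<open>j < q \<le> n\<close>, except that \<open>i\<close> must not exceed \<open>n - 1\<close>.\<close>
  define i where "i = min (m div q) (n - 1)"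
  have "q * i \<le> q * (m div q)" unfolding i_def by (intro mult_le_mono2) simp
  then have qi: "q * i \<le> m" by (rule order.trans) simp
  define j where "j = m - q * i"
  have "j < n"
  proof (cases "m div q \<le> n - 1")
    case True
    then have "j = m mod q" by (simp add: j_def i_def minus_mult_div_eq_mod)
    then show ?thesis using assms by (simp add: less_le_trans[OF mod_less_divisor])
  next
    case False
    then have "n - 1 \<le> m div q" by simp
    then have "q * (n - 1) \<le> q * (m div q)" by (rule mult_le_mono2)
    also have "\<dots> \<le> m" by simp
    finally show ?thesis using False m assms by (simp add: j_def i_def)
  qed
  moreover have "i < n" using assms by (auto simp: i_def min_def)
  moreover have "real m = real q * real i + real j" using qi unfolding j_def
    by (metis le_add_diff_inverse of_nat_add of_nat_mult)
  then have "v = real q * (u + real i * d) + (u + real j * d)" by (simp add: v algebra_simps)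
  ultimately show "v \<in> dilate_sum (real q) (progression u d n)"
    by (auto simp: progression_def intro!: dilate_sumI)
qed

lemma card_dilate_sum_inverse:
  assumes "q \<noteq> 0"
  shows "card (dilate_sum (1 / q) A) = card (dilate_sum q A)"
proof -
  have "dilate_sum (1 / q) A = (*) (1 / q) ` dilate_sum q A"
  proof (intro equalityI subsetI)
    fix v assume "v \<in> dilate_sum (1 / q) A"
    then obtain a b where ab: "a \<in> A" "b \<in> A" "v = 1 / q * a + b" by (rule dilate_sumE)
    then have "v = 1 / q * (q * b + a)" using assms by (simp add: field_simps)
    then show "v \<in> (*) (1 / q) ` dilate_sum q A" using ab by (blast intro: dilate_sumI)
  next
    fix v assume "v \<in> (*) (1 / q) ` dilate_sum q A"
    then obtain a b where ab: "a \<in> A" "b \<in> A" "v = 1 / q * (q * a + b)"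
      by (auto elim!: dilate_sumE)
    then have "v = 1 / q * b + a" using assms by (simp add: field_simps)
    then show "v \<in> dilate_sum (1 / q) A" using ab dilate_sumI by blast
  qed
  moreover have "inj_on ((*) (1 / q)) (dilate_sum q A)" using assms by (auto simp: inj_on_def)
  ultimately show ?thesis by (simp only: card_image)
qed

text \<open>
  The sums in \<open>N\<close> exceed all sums over \<open>T\<close>. The set \<open>N\<close> has two elements for \<open>q = 1\<close> and three
  otherwise, which is the source of the bounds \<open>2 n - 1\<close> and \<open>3 n - 2\<close>; if the size grows by no more
  than this, then every other sum involving \<open>x\<close> is already a sum over \<open>T\<close>.
\<close>

lemma dilate_sum_insert:
  fixes x y q :: real
  defines "N \<equiv> {q * x + x, q * x + y, q * y + x}"
  assumes fin: "finite T" and q: "0 < q" and y: "y \<in> T" "y < x" "\<And>t. t \<in> T \<Longrightarrow> t \<le> y"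
  shows "card (dilate_sum q T) + card N \<le> card (dilate_sum q (insert x T))"
    and "card (dilate_sum q (insert x T)) \<le> card (dilate_sum q T) + card N \<Longrightarrow>
      dilate_sum q (insert x T) = dilate_sum q T \<union> N"
proof -
  have "v \<le> q * y + y" if "v \<in> dilate_sum q T" for v
    using that y(3) q by (auto elim!: dilate_sumE intro!: add_mono mult_left_mono)
  moreover have "q * y + y < v" if "v \<in> N" for v
  proof -
    have "q * y < q * x" using q y(2) by simp
    then show ?thesis using that y(2) by (auto simp: N_def)
  qed
  ultimately have "dilate_sum q T \<inter> N = {}" by (meson disjoint_iff not_le)
  then have card: "card (dilate_sum q T \<union> N) = card (dilate_sum q T) + card N"
    using fin by (intro card_Un_disjoint) (auto simp: finite_dilate_sum N_def)
  have sub: "dilate_sum q T \<union> N \<subseteq> dilate_sum q (insert x T)"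
    using y(1) by (auto simp: N_def elim!: dilate_sumE intro!: dilate_sumI)
  have fin': "finite (dilate_sum q (insert x T))" using fin by (simp add: finite_dilate_sum)
  show "card (dilate_sum q T) + card N \<le> card (dilate_sum q (insert x T))"
    using card_mono[OF fin' sub] card by simp
  show "dilate_sum q (insert x T) = dilate_sum q T \<union> N"
    if "card (dilate_sum q (insert x T)) \<le> card (dilate_sum q T) + card N"
    using card_seteq[OF fin' sub] that card by simp
qed

lemma card_dilate_sum_one_ge:
  assumes "finite A"
  shows "2 * card A \<le> card (dilate_sum 1 A) + 1"
  using assms
proof (induction rule: finite_linorder_max_induct)
  case (insert x T)
  show ?case
  proof (cases "T = {}")
    case True
    then show ?thesis by (simp add: dilate_sum_def)
  next
    case False
    have y: "Max T \<in> T" "Max T < x" "\<And>t. t \<in> T \<Longrightarrow> t \<le> Max T" using insert False by auto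
    have "card {1 * x + x, 1 * x + Max T, 1 * Max T + x} = 2"
      using y(2) by (simp add: card_insert_if)
    then show ?thesis
      using dilate_sum_insert(1)[OF insert(1) zero_less_one y] insert by auto
  qed
qed simp

lemma card_dilate_sum_two_ge:
  assumes "finite A"
  shows "3 * card A \<le> card (dilate_sum 2 A) + 2"
  using assms
proof (induction rule: finite_linorder_max_induct)
  case (insert x T)
  show ?case
  proof (cases "T = {}")
    case True
    then show ?thesis by (simp add: dilate_sum_def)
  next
    case False
    have y: "Max T \<in> T" "Max T < x" "\<And>t. t \<in> T \<Longrightarrow> t \<le> Max T" using insert False by auto
    have "card {2 * x + x, 2 * x + Max T, 2 * Max T + x} = 3"
      using y(2) by (simp add: card_insert_if)
    then show ?thesis
      using dilate_sum_insert(1)[OF insert(1) _ y, of 2] insert by auto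
  qed
qed simp


lemma progression_if_card_le_2:
  assumes "finite A" "A \<noteq> {}" "card A \<le> 2"
  shows "\<exists>u d. 0 < d \<and> A = progression u d (card A)"
proof -
  have "card A = 1 \<or> card A = 2" using assms by (auto simp: le_Suc_eq numeral_2_eq_2)
  then consider x where "A = {x}" | x y where "A = {x, y}" "x < y"
    by (metis card_1_singletonE card_2_iff insert_commute linorder_less_linear)
  then show ?thesis
  proof cases
    case 1
    then have "A = progression x 1 (card A)" by (auto simp: progression_def)
    then show ?thesis using zero_less_one by blast
  next
    case 2
    then have "A = progression x (y - x) (card A)" "0 < y - x"
      by (auto simp: progression_def lessThan_Suc numeral_2_eq_2)
    then show ?thesis by blast
  qed
qed

text \<open>
  In the extremal case \<open>T = A - {x}\<close> is extremal too, hence a progression, say with difference \<open>d\<close> and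
  last terms \<open>y'\<close> and \<open>y\<close>. Since \<open>x + y'\<close> is below \<open>x + y\<close>, it is a sum over \<open>T\<close>, so \<open>x\<close> differs from \<open>y\<close> by
  a multiple of \<open>d\<close>; moreover \<open>x + y'\<close> is at most \<open>2 y\<close>, so \<open>x = y + d\<close>.
\<close>

lemma progression_if_card_dilate_sum_one:
  assumes "finite A" "A \<noteq> {}" "card (dilate_sum 1 A) + 1 \<le> 2 * card A"
  shows "\<exists>u d. 0 < d \<and> A = progression u d (card A)"
  using assms
proof (induction rule: finite_linorder_max_induct)
  case empty
  then show ?case by simp
next
  case (insert x T)
  show ?case
  proof (cases "card T \<le> 1")
    case True
    then show ?thesis using insert(1,2) by (intro progression_if_card_le_2) (auto simp: card_insert_if)
  next
    case False
    define n y where "n = card T" and "y = Max T"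
    have n: "2 \<le> n" using False by (simp add: n_def)
    have ne: "T \<noteq> {}" using n by (auto simp: n_def)
    have y: "y \<in> T" "y < x" "\<And>t. t \<in> T \<Longrightarrow> t \<le> y" using insert ne by (auto simp: y_def)
    let ?N = "{1 * x + x, 1 * x + y, 1 * y + x}"
    have cN: "card ?N = 2" using y(2) by (simp add: card_insert_if)
    have cx: "card (insert x T) = Suc n" using insert(1,2) by (auto simp: n_def)
    have "card (dilate_sum 1 T) + 1 \<le> 2 * card T"
      using dilate_sum_insert(1)[OF insert(1) zero_less_one y] insert.prems cN cx n_def by simp
    then obtain u d where d: "0 < d" and T: "T = progression u d n"
      using insert.IH ne n_def by blast
    have "card (dilate_sum 1 (insert x T)) \<le> card (dilate_sum 1 T) + 2"
      using card_dilate_sum_one_ge[OF insert(1)] insert.prems(2) cx n_def by simp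
    then have all: "dilate_sum 1 (insert x T) = dilate_sum 1 T \<union> ?N"
      using dilate_sum_insert(2)[OF insert(1) zero_less_one y] cN by presburger
    have last: "u + real (n - 1) * d \<in> T" "u + real (n - 2) * d \<in> T"
      unfolding T using n progressionI[of "n - 1" n u d] progressionI[of "n - 2" n u d] by simp_all
    have lt: "u + real (n - 2) * d < u + real (n - 1) * d" using d n by simp
    have "1 * x + (u + real (n - 2) * d) \<in> dilate_sum 1 (insert x T)"
      using last by (intro dilate_sumI) auto
    moreover have "u + real (n - 2) * d < y" using lt y(3)[OF last(1)] by linarith
    ultimately have "1 * x + (u + real (n - 2) * d) \<in> dilate_sum 1 T"
      using y(2) unfolding all by auto
    then obtain i j where ij: "i < n" "j < n"
      and eq: "x + (u + real (n - 2) * d) = (u + real i * d) + (u + real j * d)"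
      by (auto simp: T progression_def elim!: dilate_sumE)
    have x: "x = u + (real i + real j - real n + 2) * d"
      using eq n by (simp add: of_nat_diff algebra_simps)
    have "u + (real n - 1) * d < u + (real i + real j - real n + 2) * d"
      using y(2) y(3)[OF last(1)] n unfolding x[symmetric] by (simp add: of_nat_diff)
    then have "real n - 1 < real i + real j - real n + 2" using d by simp
    then have "i + j + 2 = 2 * n" using ij by linarith
    then have "real i + real j - real n + 2 = real n" by linarith
    then have "x = u + real n * d" unfolding x by simp
    then have "insert x T = progression u d (card (insert x T))"
      using d unfolding T by (simp add: insert_progression card_progression)
    then show ?thesis using d by blast
  qed
qed

text \<open>
  The argument is the same, with \<open>x + 2 y'\<close> as the sum over \<open>T\<close>. It leaves two possibilities,
  \<open>x = y + d\<close> and \<open>x = y + 2 d\<close>, and the second fails because then \<open>2 x + y' = 3 y + 3 d\<close> is neither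
  a sum over \<open>T\<close> nor one of \<open>3 x\<close>, \<open>2 x + y\<close>, \<open>x + 2 y\<close>.
\<close>

lemma progression_if_card_dilate_sum_two:
  assumes "finite A" "A \<noteq> {}" "card (dilate_sum 2 A) + 2 \<le> 3 * card A"
  shows "\<exists>u d. 0 < d \<and> A = progression u d (card A)"
  using assms
proof (induction rule: finite_linorder_max_induct)
  case empty
  then show ?case by simp
next
  case (insert x T)
  show ?case
  proof (cases "card T \<le> 1")
    case True
    then show ?thesis using insert(1,2) by (intro progression_if_card_le_2) (auto simp: card_insert_if)
  next
    case False
    define n y where "n = card T" and "y = Max T"
    have n: "2 \<le> n" using False by (simp add: n_def)
    have ne: "T \<noteq> {}" using n by (auto simp: n_def)
    have y: "y \<in> T" "y < x" "\<And>t. t \<in> T \<Longrightarrow> t \<le> y" using insert ne by (auto simp: y_def)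
    let ?N = "{2 * x + x, 2 * x + y, 2 * y + x}"
    have cN: "card ?N = 3" using y(2) by (simp add: card_insert_if)
    have cx: "card (insert x T) = Suc n" using insert(1,2) by (auto simp: n_def)
    have "card (dilate_sum 2 T) + 2 \<le> 3 * card T"
      using dilate_sum_insert(1)[OF insert(1) _ y, of 2] insert.prems cN cx n_def by simp
    then obtain u d where d: "0 < d" and T: "T = progression u d n"
      using insert.IH ne n_def by blast
    have "card (dilate_sum 2 (insert x T)) \<le> card (dilate_sum 2 T) + 3"
      using card_dilate_sum_two_ge[OF insert(1)] insert.prems(2) cx n_def by simp
    then have all: "dilate_sum 2 (insert x T) = dilate_sum 2 T \<union> ?N"
      using dilate_sum_insert(2)[OF insert(1) _ y, of 2] cN by (metis zero_less_numeral)
    have last: "u + real (n - 1) * d \<in> T" "u + real (n - 2) * d \<in> T"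
      unfolding T using n progressionI[of "n - 1" n u d] progressionI[of "n - 2" n u d] by simp_all
    have lt: "u + real (n - 2) * d < u + real (n - 1) * d" using d n by simp
    have y': "u + real (n - 2) * d < y" using lt y(3)[OF last(1)] by linarith
    have yl: "y = u + real (n - 1) * d"
    proof -
      obtain i where i: "i < n" "y = u + real i * d" using y(1) by (auto simp: T progression_def)
      then have "real i * d \<le> real (n - 1) * d" using d by (intro mult_right_mono) auto
      then show ?thesis using y(3)[OF last(1)] i by linarith
    qed
    have "2 * (u + real (n - 2) * d) + x \<in> dilate_sum 2 (insert x T)"
      using last by (intro dilate_sumI) auto
    then have "2 * (u + real (n - 2) * d) + x \<in> dilate_sum 2 T"
      using y(2) y' unfolding all by auto
    then obtain i j where ij: "i < n" "j < n"
      and eq: "2 * (u + real (n - 2) * d) + x = 2 * (u + real i * d) + (u + real j * d)"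
      by (auto simp: T progression_def elim!: dilate_sumE)
    have x: "x = u + (2 * real i + real j - 2 * real n + 4) * d"
      using eq n by (simp add: of_nat_diff algebra_simps)
    have "u + (real n - 1) * d < u + (2 * real i + real j - 2 * real n + 4) * d"
      using y(2) n unfolding yl x[symmetric] by (simp add: of_nat_diff)
    then have "real n - 1 < 2 * real i + real j - 2 * real n + 4" using d by simp
    then have "2 * i + j + 4 = 3 * n \<or> 2 * i + j + 3 = 3 * n" using ij by linarith
    then have "x = u + real n * d"
    proof
      assume "2 * i + j + 4 = 3 * n"
      then have "2 * real i + real j - 2 * real n + 4 = real n" by linarith
      then show ?thesis unfolding x by simp
    next
      assume "2 * i + j + 3 = 3 * n"
      then have "2 * real i + real j - 2 * real n + 4 = real n + 1" by linarith
      then have x1: "x = u + (real n + 1) * d" unfolding x by simp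
      have "2 * x + (u + real (n - 2) * d) \<in> dilate_sum 2 (insert x T)"
        using last by (intro dilate_sumI) auto
      moreover have "2 * x + (u + real (n - 2) * d) \<notin> ?N"
        using d n by (auto simp: x1 yl of_nat_diff algebra_simps)
      ultimately have "2 * x + (u + real (n - 2) * d) \<in> dilate_sum 2 T"
        unfolding all by blast
      then obtain a b where "a \<in> T" "b \<in> T" "2 * x + (u + real (n - 2) * d) = 2 * a + b"
        by (rule dilate_sumE)
      then have "2 * x + (u + real (n - 2) * d) \<le> 3 * y" using y(3)[of a] y(3)[of b] by simp
      then show ?thesis using d n by (simp add: x1 yl of_nat_diff algebra_simps)
    qed
    then have "insert x T = progression u d (card (insert x T))"
      using d unfolding T by (simp add: insert_progression card_progression)
    then show ?thesis using d by blast
  qed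
qed

text \<open>
  Multiplication by \<open>q\<close> moves the last term \<open>M\<close> out of \<open>A\<close>, so it maps all other terms into \<open>A\<close>. From
  the first term, \<open>u \<ge> 0\<close>; from the first two, \<open>q\<close> is an integer and so at least 2; and the last but
  one term satisfies \<open>q (u + (n - 2) d) \<le> u + (n - 1) d\<close>, which leaves only \<open>n = 3\<close>, \<open>q = 2\<close>, \<open>u = 0\<close>.
\<close>

lemma dilate_progression_almost_invariant:
  assumes d: "0 < d" and n: "3 \<le> n" and q: "1 < q" and A: "A = progression u d n"
    and last: "0 < u + real (n - 1) * d" and card: "card (A \<union> (*) q ` A) \<le> n + 1"
  shows "q = 2 \<and> A = {0, d, 2 * d}"
proof -
  define M where "M = u + real (n - 1) * d"
  have fin: "finite A" by (simp add: A progression_def)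
  have cA: "card A = n" using d by (simp add: A card_progression)
  have le: "u \<le> a" "a \<le> M" if a: "a \<in> A" for a
  proof -
    obtain i where i: "i < n" "a = u + real i * d" using a by (auto simp: A progression_def)
    have "real i * d \<le> real (n - 1) * d" using d i by (intro mult_right_mono) auto
    then show "u \<le> a" "a \<le> M" using i d by (auto simp: M_def)
  qed
  have "M \<in> A" unfolding A M_def using n progressionI[of "n - 1" n u d] by simp
  have "M < q * M" using q last by (simp add: M_def)
  then have qM: "q * M \<notin> A" using le(2) by force
  have inv: "q * a \<in> A" if "a \<in> A" "a \<noteq> M" for a
  proof (rule ccontr)
    assume "q * a \<notin> A"
    then have "card (insert (q * a) (insert (q * M) A)) = n + 2"
      using fin cA qM q that by simp
    moreover have "insert (q * a) (insert (q * M) A) \<subseteq> A \<union> (*) q ` A"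
      using that \<open>M \<in> A\<close> by auto
    then have "card (insert (q * a) (insert (q * M) A)) \<le> card (A \<union> (*) q ` A)"
      using fin by (intro card_mono) auto
    ultimately show False using card by simp
  qed
  have mem: "u + real i * d \<in> A" if "i < n" for i unfolding A using that by (rule progressionI)
  have neM: "u + real i * d \<noteq> M" if "i < n - 1" for i using that d by (auto simp: M_def)
  have qi: "q * (u + real i * d) \<in> A" if "i < n - 1" for i
    using that by (intro inv mem neM) auto
  have "u \<le> q * u" using le(1)[OF qi[of 0]] n by simp
  then have u: "0 \<le> u" using q by (simp add: mult_le_cancel_right1)
  have "q * u \<in> A" "q * (u + d) \<in> A" using qi[of 0] qi[of 1] n by simp_all
  then obtain i j where "q * u = u + real i * d" "q * (u + d) = u + real j * d"
    by (auto simp: A progression_def)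
  then have "q * d = (real j - real i) * d" by (simp add: algebra_simps)
  moreover define k where "k = int j - int i"
  ultimately have "q = of_int k" using d by simp
  then have q2: "2 \<le> q" using q by simp
  have "q * (u + real (n - 2) * d) \<le> M" using n by (intro le(2) qi) auto
  then have *: "(q - 1) * u + (q * real (n - 2) - real (n - 1)) * d \<le> 0"
    by (simp add: M_def algebra_simps)
  moreover have qu: "0 \<le> (q - 1) * u" using u q by simp
  ultimately have "(q * real (n - 2) - real (n - 1)) * d \<le> 0" by linarith
  then have q_le: "q * real (n - 2) \<le> real (n - 1)" using d by (simp add: mult_le_0_iff)
  have "2 * real (n - 2) \<le> q * real (n - 2)" using q2 by (intro mult_right_mono) auto
  then have n3: "n = 3" using q_le n by linarith
  then have "q = 2" using q_le q2 by simp
  then have "u = 0" using * qu n3 by simp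
  then show ?thesis using \<open>q = 2\<close> n3 by (auto simp: A progression_def numeral_3_eq_3 lessThan_Suc)
qed

lemma image_dilate_swap:
  assumes "(q::real) \<noteq> 0"
  shows "card (A \<union> (*) (1 / q) ` A) = card (A \<union> (*) q ` A)"
proof -
  have "A \<union> (*) q ` A = (*) q ` (A \<union> (*) (1 / q) ` A)"
    using assms by (auto simp: image_Un image_image)
  moreover have "inj_on ((*) q) (A \<union> (*) (1 / q) ` A)" using assms by (auto simp: inj_on_def)
  ultimately show ?thesis by (metis card_image)
qed

lemma progression_uminus: "uminus ` progression u d n = progression (- u - real (n - 1) * d) d n"
proof -
  have "uminus ` progression u d n \<subseteq> progression (- u - real (n - 1) * d) d n" for u
  proof
    fix v assume "v \<in> uminus ` progression u d n"
    then obtain i where "i < n" "v = - (u + real i * d)" by (auto simp: progression_def)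
    then show "v \<in> progression (- u - real (n - 1) * d) d n"
      unfolding progression_def
      by (intro image_eqI[of _ _ "n - 1 - i"]) (auto simp: of_nat_diff algebra_simps)
  qed
  note sub = this
  show ?thesis
  proof
    show "progression (- u - real (n - 1) * d) d n \<subseteq> uminus ` progression u d n"
    proof
      fix v assume "v \<in> progression (- u - real (n - 1) * d) d n"
      then have "- v \<in> progression u d n" using sub[of "- u - real (n - 1) * d"] by auto
      then have "- (- v) \<in> uminus ` progression u d n" by (rule imageI)
      then show "v \<in> uminus ` progression u d n" by simp
    qed
  qed (rule sub)
qed

text \<open>
  If \<open>q A\<close> were contained in \<open>A\<close>, both would be equal, and the maximum and the minimum of \<open>A\<close> would be
  fixed by the dilation, hence be 0.
\<close>

lemma card_Un_dilate_ge:
  assumes fin: "finite A" and A: "A \<noteq> {0}" "A \<noteq> {}" and q: "0 < q" "q \<noteq> (1::real)"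
  shows "card A + 1 \<le> card (A \<union> (*) q ` A)"
proof (rule ccontr)
  assume "\<not> ?thesis"
  then have "A = A \<union> (*) q ` A" using fin by (intro card_seteq) auto
  moreover have "card ((*) q ` A) = card A" using q by (intro card_image) (auto simp: inj_on_def)
  ultimately have eq: "(*) q ` A = A" using fin by (metis card_subset_eq sup.cobounded2)
  have fixed: "a = 0" if a: "a \<in> A" and ext: "(\<forall>b\<in>A. b \<le> a) \<or> (\<forall>b\<in>A. a \<le> b)" for a
  proof -
    have qa: "q * a \<in> A" using eq a by blast
    obtain b where b: "b \<in> A" "a = q * b" using eq a by blast
    from ext have "q * a = a"
    proof
      assume "\<forall>b\<in>A. b \<le> a"
      then have "q * a \<le> a" "q * b \<le> q * a" using qa b(1) q(1) by simp_all
      then show ?thesis using b(2) by simp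
    next
      assume "\<forall>b\<in>A. a \<le> b"
      then have "a \<le> q * a" "q * a \<le> q * b" using qa b(1) q(1) by simp_all
      then show ?thesis using b(2) by simp
    qed
    then show ?thesis using q by simp
  qed
  have "Max A = 0" "Min A = 0"
    using Max_in[OF fin A(2)] Min_in[OF fin A(2)] fin by (auto intro: fixed)
  then have "a = 0" if "a \<in> A" for a
    using Max_ge[OF fin that] Min_le[OF fin that] by simp
  then show False using A by auto
qed

text \<open>
  Both summands are bounded below, by \<open>2 n - 1\<close> and \<open>n + 1\<close>, so both bounds are attained. The two
  normalisations needed for \<open>dilate_progression_almost_invariant\<close> are harmless: \<open>A \<union> q A\<close> has as many
  elements as \<open>A \<union> (1/q) A\<close>, and \<open>- A\<close> is again a progression.
\<close>

lemma image_dilate_invariants: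
  assumes fin: "finite A" and card: "3 \<le> card A" and q: "0 < q" "q \<noteq> (1::real)"
    and small: "card (dilate_sum 1 A) + card (A \<union> (*) q ` A) \<le> 3 * card A"
  shows "(q = 2 \<or> q = 1 / 2) \<and> (\<exists>d. d \<noteq> 0 \<and> A = {0, d, 2 * d})"
proof -
  let ?n = "card A"
  have ne: "A \<noteq> {}" "A \<noteq> {0}" using card by auto
  have "?n + 1 \<le> card (A \<union> (*) q ` A)" using card_Un_dilate_ge[OF fin ne(2,1) q] .
  then have "card (dilate_sum 1 A) + 1 \<le> 2 * ?n" and upper: "card (A \<union> (*) q ` A) \<le> ?n + 1"
    using small card_dilate_sum_one_ge[OF fin] by linarith+
  then obtain u d where d: "0 < d" and A: "A = progression u d ?n"
    using progression_if_card_dilate_sum_one[OF fin ne(1)] by blast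
  define r where "r = (if 1 < q then q else 1 / q)"
  have r: "1 < r" using q by (auto simp: r_def)
  have cr: "card (A \<union> (*) r ` A) \<le> ?n + 1"
    using upper image_dilate_swap[of q A] q by (simp add: r_def)
  have "r = 2 \<and> (A = {0, d, 2 * d} \<or> A = {0, - d, 2 * - d})"
  proof (cases "0 < u + real (?n - 1) * d")
    case True
    then show ?thesis
      using dilate_progression_almost_invariant[OF d card r A _ cr] by blast
  next
    case False
    let ?B = "uminus ` A"
    have cB: "card ?B = ?n" by (simp add: card_image)
    have "?B = progression (- u - real (?n - 1) * d) d ?n"
      using progression_uminus[of u d ?n] A by simp
    moreover have "real (?n - 1) * d > 0" using d card by simp
    then have "0 < - u - real (?n - 1) * d + real (?n - 1) * d" using False by linarith
    moreover have "?B \<union> (*) r ` ?B = uminus ` (A \<union> (*) r ` A)" by (auto simp: image_Un image_image)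
    then have "card (?B \<union> (*) r ` ?B) \<le> ?n + 1" using cr by (simp add: card_image)
    ultimately have "r = 2 \<and> ?B = {0, d, 2 * d}"
      using dilate_progression_almost_invariant[OF d card r] by blast
    moreover have "A = uminus ` ?B" by (simp add: image_image)
    ultimately show ?thesis by auto
  qed
  moreover have "q = 2 \<or> q = 1 / 2" if "r = 2" using that q by (auto simp: r_def field_simps split: if_splits)
  moreover have "d \<noteq> 0" "- d \<noteq> 0" using d by auto
  ultimately show ?thesis by blast
qed

section \<open>Small doubling in the affine group\<close>

lemma set_mult_same_ht: "Aff e ` A * Aff e ` A = Aff (2 * e) ` dilate_sum (2 powi e) A"
  by (auto simp: set_times_def dilate_sum_def times_aff_def image_iff)

lemma card_image_Aff [simp]: "card (Aff e ` A) = card A"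
  by (rule card_image) (auto simp: inj_on_def)

lemma same_ht_image: "(\<And>s. s \<in> S \<Longrightarrow> ht s = e) \<Longrightarrow> S = Aff e ` (tr ` S)"
  by (force simp: image_image)

lemma two_powi_inj: "(2::real) powi m = 2 powi n \<longleftrightarrow> m = n"
  using power_int_strict_increasing[of m n "2::real"] power_int_strict_increasing[of n m "2::real"]
  by (metis less_irrefl linorder_less_linear one_less_numeral_iff semiring_norm(76))

lemma two_powi_eq_2_iff: "(2::real) powi e = 2 \<longleftrightarrow> e = 1"
  using two_powi_inj[of e 1] by simp

lemma two_powi_minus_one: "(2::real) powi (- 1) = 1 / 2"
  by (simp add: power_int_minus)

lemma two_powi_eq_half_iff: "(2::real) powi e = 1 / 2 \<longleftrightarrow> e = - 1"
  using two_powi_inj[of e "-1"] unfolding two_powi_minus_one .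

text \<open>
  For \<open>e = -1\<close> the product set corresponds to \<open>(1/2) A + A\<close>, a rescaled copy of \<open>A + 2 A\<close>.
\<close>

lemma card_mult_one_ht_iff:
  assumes fin: "finite A" and card: "2 \<le> card A" and e: "e = 1 \<or> e = - 1"
  shows "card (Aff e ` A * Aff e ` A) = 3 * card A - 2 \<longleftrightarrow>
    (\<exists>u d. d \<noteq> 0 \<and> A = progression u d (card A))"
proof -
  have "card (dilate_sum (2 powi e) A) = card (dilate_sum 2 A)"
    using e card_dilate_sum_inverse[of 2 A] two_powi_minus_one by auto
  then have cards: "card (Aff e ` A * Aff e ` A) = card (dilate_sum 2 A)"
    by (simp add: set_mult_same_ht)
  have ne: "A \<noteq> {}" using card by auto
  show ?thesis
  proof
    assume "card (Aff e ` A * Aff e ` A) = 3 * card A - 2"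
    then have "card (dilate_sum 2 A) + 2 \<le> 3 * card A" using cards card by simp
    then show "\<exists>u d. d \<noteq> 0 \<and> A = progression u d (card A)"
      using progression_if_card_dilate_sum_two[OF fin ne] by (metis less_irrefl)
  next
    assume "\<exists>u d. d \<noteq> 0 \<and> A = progression u d (card A)"
    then obtain u d where d: "d \<noteq> 0" and A: "A = progression u d (card A)" by blast
    have "card (dilate_sum (real 2) (progression u d (card A))) = Suc (2 * (card A - 1) + (card A - 1))"
      using dilate_sum_progression[of 2 "card A" u d] card d by (simp add: card_progression)
    then show "card (Aff e ` A * Aff e ` A) = 3 * card A - 2"
      using card A cards by simp
  qed
qed

text \<open>
  The three summands count the products of heights \<open>0\<close>, \<open>e\<close> and \<open>2 e\<close>. In the middle height, a
  translation by \<open>m\<close> contributes \<open>m + n\<close> as a right factor and \<open>2\<^sup>e m + n\<close> as a left factor.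
\<close>

lemma card_mult_insert_ht_zero:
  assumes fin: "finite A" and e: "e \<noteq> 0"
  shows "card (insert (Aff e n) (Aff 0 ` A) * insert (Aff e n) (Aff 0 ` A))
    = card (dilate_sum 1 A) + card (A \<union> (*) (2 powi e) ` A) + 1"
proof -
  let ?B = "A \<union> (*) (2 powi e) ` A" and ?x = "Aff e n"
  have "insert ?x (Aff 0 ` A) * insert ?x (Aff 0 ` A)
      = Aff 0 ` A * Aff 0 ` A \<union> ((*) ?x ` Aff 0 ` A \<union> (\<lambda>t. t * ?x) ` Aff 0 ` A) \<union> {?x * ?x}"
    by (auto simp: set_times_def)
  also have "(*) ?x ` Aff 0 ` A \<union> (\<lambda>t. t * ?x) ` Aff 0 ` A = Aff e ` (\<lambda>b. b + n) ` ?B"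
    by (auto simp: times_aff_def image_Un image_image add.commute)
  finally have eq: "insert ?x (Aff 0 ` A) * insert ?x (Aff 0 ` A)
      = Aff 0 ` dilate_sum 1 A \<union> Aff e ` (\<lambda>b. b + n) ` ?B \<union> {?x * ?x}"
    by (simp add: set_mult_same_ht)
  have finB: "finite ?B" and finD: "finite (dilate_sum 1 A)" using fin by (auto simp: finite_dilate_sum)
  have "card (Aff e ` (\<lambda>b. b + n) ` ?B) = card ?B" by (simp add: card_image)
  moreover have "Aff 0 ` dilate_sum 1 A \<inter> Aff e ` (\<lambda>b. b + n) ` ?B = {}" using e by auto
  moreover have "?x * ?x \<notin> Aff 0 ` dilate_sum 1 A \<union> Aff e ` (\<lambda>b. b + n) ` ?B"
    using e by (auto simp: times_aff_def)
  ultimately show ?thesis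
    unfolding eq using finB finD by (simp add: card_Un_disjoint)
qed

lemma Aff_power: "Aff 0 d ^ i = Aff 0 (real i * d)"
  by (induction i) (simp_all add: one_aff_def times_aff_def algebra_simps)

text \<open>
  The relations \<open>c\<^sup>x = c\<^sup>2\<close> and \<open>(c\<^sup>2)\<^sup>x = c\<close>, multiplied by \<open>x\<close> so that they make sense without inverses.
\<close>

definition doubled_by :: "'a::monoid_mult \<Rightarrow> 'a \<Rightarrow> bool" where
  "doubled_by x c \<longleftrightarrow> c * x = x * c ^ 2 \<or> c ^ 2 * x = x * c"

text \<open>
  Comparing heights shows that \<open>c\<close> is a translation; conjugation by \<open>x\<close> multiplies it by \<open>2\<^sup>e\<close>, where
  \<open>e\<close> is the height of \<open>x\<close>.
\<close>

lemma doubled_by_aff_iff: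
  assumes "c \<noteq> 1"
  shows "doubled_by x c \<longleftrightarrow> ht c = 0 \<and> (ht x = 1 \<or> ht x = - 1)"
proof (cases "ht c = 0")
  case True
  then have d: "tr c \<noteq> 0" using assms by (metis aff.expand aff.sel one_aff_def)
  have "doubled_by x c \<longleftrightarrow> 2 powi ht x = (2::real) \<or> 2 powi ht x = (1 / 2 :: real)"
    using True d by (auto simp: doubled_by_def times_aff_def power2_eq_square algebra_simps)
  then show ?thesis unfolding two_powi_eq_2_iff two_powi_eq_half_iff using True by simp
next
  case False
  have "ht (c * x) \<noteq> ht (x * c ^ 2)" "ht (c ^ 2 * x) \<noteq> ht (x * c)"
    using False by (auto simp: power2_eq_square)
  then show ?thesis using False by (metis doubled_by_def)
qed

definition geometric :: "'a::monoid_mult \<Rightarrow> 'a \<Rightarrow> nat \<Rightarrow> 'a set" where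
  "geometric x c n = (\<lambda>i. x * c ^ i) ` {..<n}"

lemma geometric_Aff: "geometric (Aff e u) (Aff 0 d) n = Aff e ` progression u d n"
proof -
  have "Aff e u * Aff 0 d ^ i = Aff e (u + real i * d)" for i
    by (simp add: Aff_power times_aff_def)
  then show ?thesis unfolding geometric_def progression_def image_image by simp
qed

text \<open>
  Noncommutativity and the condition on divisors of the heights are what a generating set \<open>S\<close> provides.
  When all elements of \<open>S\<close> have the same height, the latter forces this height to be \<open>1\<close> or \<open>-1\<close>.
\<close>

theorem small_doubling_aff:
  fixes S :: "aff set"
  assumes fin: "finite S" and nc: "\<not> pairwise_commuting S" and card: "4 \<le> card S"
    and gen: "\<And>m. (\<And>s. s \<in> S \<Longrightarrow> m dvd ht s) \<Longrightarrow> \<bar>m\<bar> = 1"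
  shows "card (S * S) = 3 * card S - 2 \<longleftrightarrow>
    (\<exists>x c. S = geometric x c (card S) \<and> c \<noteq> 1 \<and> doubled_by x c) \<or>
    (\<exists>x c. S = {1, c, c ^ 2, x} \<and> card S = 4 \<and> doubled_by x c)"
proof
  assume small: "card (S * S) = 3 * card S - 2"
  show "(\<exists>x c. S = geometric x c (card S) \<and> c \<noteq> 1 \<and> doubled_by x c) \<or>
    (\<exists>x c. S = {1, c, c ^ 2, x} \<and> card S = 4 \<and> doubled_by x c)"
  proof (cases "\<exists>s\<in>S. \<exists>t\<in>S. ht s \<noteq> ht t")
    case True
    have "card (S * S) + 2 \<le> 3 * card S" using small card by simp
    then obtain x where x: "x \<in> S" "ht x \<noteq> 0" "\<And>t. t \<in> S - {x} \<Longrightarrow> ht t = 0"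
      using small_doubling_two_heights[OF fin nc card _ True] by blast
    define A where "A = tr ` (S - {x})"
    have T: "S - {x} = Aff 0 ` A" unfolding A_def using x(3) by (rule same_ht_image)
    then have S: "S = insert (Aff (ht x) (tr x)) (Aff 0 ` A)" using x(1) by auto
    have finA: "finite A" using fin by (simp add: A_def)
    have cA: "card A + 1 = card S"
      using x(1) fin card_Suc_Diff1[of S x] arg_cong[OF T, of card] by simp
    have "card (S * S) = card (dilate_sum 1 A) + card (A \<union> (*) (2 powi ht x) ` A) + 1"
      using card_mult_insert_ht_zero[OF finA x(2), of "tr x"] S by simp
    then have "(2 powi ht x = (2::real) \<or> 2 powi ht x = (1 / 2 :: real)) \<and>
        (\<exists>d. d \<noteq> 0 \<and> A = {0, d, 2 * d})"
      using small card cA x(2) by (intro image_dilate_invariants[OF finA]) auto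
    then obtain d where d: "d \<noteq> 0" "A = {0, d, 2 * d}" and e: "ht x = 1 \<or> ht x = - 1"
      unfolding two_powi_eq_2_iff two_powi_eq_half_iff by blast
    let ?c = "Aff 0 d"
    have "S = {1, ?c, ?c ^ 2, x}"
      unfolding S d(2) by (auto simp: Aff_power one_aff_def)
    moreover have "card S = 4" using cA d by simp
    moreover have "doubled_by x ?c" using d e by (subst doubled_by_aff_iff) (auto simp: one_aff_def)
    ultimately show ?thesis by blast
  next
    case False
    have "S \<noteq> {}" using card by auto
    then obtain s where s: "s \<in> S" by blast
    define A where "A = tr ` S"
    have ht: "ht t = ht s" if "t \<in> S" for t using False that s by blast
    then have S: "S = Aff (ht s) ` A" unfolding A_def by (rule same_ht_image)
    have e: "ht s = 1 \<or> ht s = - 1" using gen[of "ht s"] ht by auto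
    have cA: "card A = card S" using arg_cong[OF S, of card] by simp
    have finA: "finite A" using fin by (simp add: A_def)
    obtain u d where ud: "d \<noteq> 0" "A = progression u d (card A)"
      using card_mult_one_ht_iff[OF finA _ e] small card unfolding S[symmetric] cA by auto
    have "S = geometric (Aff (ht s) u) (Aff 0 d) (card S)"
      by (metis S ud(2) cA geometric_Aff)
    moreover have "Aff 0 d \<noteq> 1" using ud(1) by (simp add: one_aff_def)
    moreover have "doubled_by (Aff (ht s) u) (Aff 0 d)"
      using e ud(1) by (subst doubled_by_aff_iff) (auto simp: one_aff_def)
    ultimately show ?thesis by blast
  qed
next
  assume "(\<exists>x c. S = geometric x c (card S) \<and> c \<noteq> 1 \<and> doubled_by x c) \<or>
    (\<exists>x c. S = {1, c, c ^ 2, x} \<and> card S = 4 \<and> doubled_by x c)"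
  then show "card (S * S) = 3 * card S - 2"
  proof (elim disjE exE conjE)
    fix x c :: aff
    assume S: "S = geometric x c (card S)" and c: "c \<noteq> 1" "doubled_by x c"
    then have e: "ht c = 0" "ht x = 1 \<or> ht x = - 1" by (auto simp: doubled_by_aff_iff)
    have d: "tr c \<noteq> 0" using c(1) e(1) by (metis aff.expand aff.sel one_aff_def)
    let ?A = "progression (tr x) (tr c) (card S)"
    have S': "S = Aff (ht x) ` ?A"
      using S e(1) geometric_Aff[of "ht x" "tr x" "tr c" "card S"] by (metis aff.collapse)
    have cA: "card ?A = card S" using d by (rule card_progression)
    have "card (Aff (ht x) ` ?A * Aff (ht x) ` ?A) = 3 * card ?A - 2"
      using cA d card by (subst card_mult_one_ht_iff[OF _ _ e(2)]) (auto simp: progression_def)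
    then show ?thesis using S' cA by simp
  next
    fix x c :: aff
    assume S: "S = {1, c, c ^ 2, x}" and c4: "card S = 4" and c: "doubled_by x c"
    have "c \<noteq> 1" using c4 S by (auto simp: card_insert_if split: if_splits)
    with c have e: "ht c = 0" "ht x = 1 \<or> ht x = - 1" by (auto simp: doubled_by_aff_iff)
    define d where "d = tr c"
    have cd: "c = Aff 0 d" using e(1) by (simp add: d_def aff.expand)
    then have d: "d \<noteq> 0" using \<open>c \<noteq> 1\<close> by (auto simp: one_aff_def)
    let ?A = "progression 0 d 3"
    have A: "?A = {0, d, 2 * d}" by (auto simp: progression_def numeral_3_eq_3 lessThan_Suc)
    have S': "S = insert (Aff (ht x) (tr x)) (Aff 0 ` ?A)"
      unfolding S A cd by (auto simp: Aff_power one_aff_def)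
    have c5: "card (dilate_sum 1 ?A) = 5"
      using dilate_sum_progression[of 1 3 0 d] d by (simp add: card_progression)
    have "card ({0, d, 2 * d} \<union> (*) 2 ` {0, d, 2 * d}) = 4" using d by (simp add: card_insert_if)
    then have two: "card (?A \<union> (*) 2 ` ?A) = 4" unfolding A .
    have c4': "card (?A \<union> (*) (2 powi ht x) ` ?A) = 4"
      using e(2)
    proof
      assume "ht x = 1"
      then have "(2::real) powi ht x = 2" by simp
      then show ?thesis using two by presburger
    next
      assume "ht x = - 1"
      then have half: "(2::real) powi ht x = 1 / 2" using two_powi_minus_one by simp
      have "card (?A \<union> (*) (1 / 2) ` ?A) = card (?A \<union> (*) 2 ` ?A)"
        by (rule image_dilate_swap) simp
      then show ?thesis unfolding half using two by linarith
    qed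
    have "card (S * S) = card (dilate_sum 1 ?A) + card (?A \<union> (*) (2 powi ht x) ` ?A) + 1"
      unfolding S' using e(2) by (intro card_mult_insert_ht_zero) (auto simp: progression_def)
    then have "card (S * S) = 10" unfolding c5 c4' by simp
    then show ?thesis using c4 by simp
  qed
qed

section \<open>Embedding BS(1,2) into the affine group\<close>

abbreviation bs_relation :: "(bs_gen gword \<times> bs_gen gword) set" where
  "bs_relation \<equiv>
     {([(False, Gen_b), (True, Gen_a), (True, Gen_b)], [(True, Gen_a), (True, Gen_a)])}"

fun letter_value :: "bool \<times> bs_gen \<Rightarrow> aff" where
  "letter_value (s, Gen_a) = Aff 0 (if s then 1 else - 1)"
| "letter_value (s, Gen_b) = Aff (if s then 1 else - 1) 0"

definition word_value :: "bs_gen gword \<Rightarrow> aff" where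
  "word_value w = prod_list (map letter_value w)"

lemma word_value_append: "word_value (u @ v) = word_value u * word_value v"
  by (simp add: word_value_def)

lemma word_value_cong: "word_eq bs_relation u v \<Longrightarrow> word_value u = word_value v"
proof (induction rule: word_eq.induct)
  case (cancel u s x v)
  have "letter_value (s, x) * letter_value (\<not> s, x) = 1"
    by (cases x) (auto simp: times_aff_def one_aff_def)
  then have "word_value [(s, x), (\<not> s, x)] = 1" by (simp add: word_value_def)
  then have "word_value ([(s, x), (\<not> s, x)] @ v) = word_value v"
    by (simp only: word_value_append mult_1_left)
  then show ?case by (simp only: word_value_append)
next
  case (relation l r u v)
  then have "word_value l = word_value r"
    by (auto simp: word_value_def times_aff_def one_aff_def)
  then show ?case by (simp add: word_value_append)
qed simp_all

context group
begin


lemma int_pow_doubling: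
  assumes a: "a \<in> carrier G" and b: "b \<in> carrier G" and rel: "inv b \<otimes> a \<otimes> b = a \<otimes> a"
  shows "a [^] (m::int) \<otimes> b = b \<otimes> a [^] (2 * m)"
proof -
  let ?h = "\<lambda>x. inv b \<otimes> x \<otimes> b"
  have "?h (x \<otimes> y) = ?h x \<otimes> ?h y" if "x \<in> carrier G" "y \<in> carrier G" for x y
  proof -
    have "?h x \<otimes> ?h y = inv b \<otimes> x \<otimes> (b \<otimes> inv b) \<otimes> y \<otimes> b"
      using that b by (simp only: m_assoc m_closed inv_closed)
    then show ?thesis using that b by (simp add: m_assoc)
  qed
  then have "?h \<in> hom G G" using b by (intro homI) auto
  then have "?h (a [^] m) = (a \<otimes> a) [^] m"
    using hom_int_pow[of ?h G G a m] a is_group rel by simp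
  also have "a \<otimes> a = a [^] (2::int)"
    using int_pow_mult[OF a, of 1 1] a by simp
  also have "(a [^] (2::int)) [^] m = a [^] (2 * m)" using a by (simp add: int_pow_pow)
  finally have "inv b \<otimes> (a [^] m \<otimes> b) = a [^] (2 * m)" using a b by (simp add: m_assoc)
  then show ?thesis using a b by (simp add: inv_solve_left')
qed

lemma int_pow_doubling_nat_pow:
  assumes a: "a \<in> carrier G" and b: "b \<in> carrier G" and rel: "inv b \<otimes> a \<otimes> b = a \<otimes> a"
  shows "a [^] (m::int) \<otimes> b [^] (i::nat) = b [^] i \<otimes> a [^] (2 ^ i * m)"
proof (induction i arbitrary: m)
  case (Suc i)
  have "a [^] m \<otimes> b [^] Suc i = a [^] m \<otimes> b [^] i \<otimes> b" using a b by (simp add: m_assoc)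
  also have "\<dots> = b [^] i \<otimes> (a [^] (2 ^ i * m) \<otimes> b)" using a b Suc.IH by (simp add: m_assoc)
  also have "\<dots> = b [^] Suc i \<otimes> a [^] (2 ^ Suc i * m)"
    using a b by (simp add: int_pow_doubling[OF a b rel] m_assoc mult.assoc)
  finally show ?case .
qed (use a in simp)

text \<open>
  The normal form \<open>b\<^sup>i a\<^sup>m b\<^sup>-\<^sup>j\<close> of elements of \<open>BS(1,2)\<close>. Left multiplication by the generators
  and their inverses takes such elements to elements of the same form.
\<close>

definition bs_normal :: "'a \<Rightarrow> 'a \<Rightarrow> nat \<Rightarrow> int \<Rightarrow> nat \<Rightarrow> 'a" where
  "bs_normal a b i m j = b [^] i \<otimes> a [^] m \<otimes> inv b [^] j"

lemma bs_normal_mult: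
  assumes a: "a \<in> carrier G" and b: "b \<in> carrier G" and rel: "inv b \<otimes> a \<otimes> b = a \<otimes> a"
  shows "a [^] (n::int) \<otimes> bs_normal a b i m j = bs_normal a b i (2 ^ i * n + m) j"
    and "b \<otimes> bs_normal a b i m j = bs_normal a b (Suc i) m j"
    and "inv b \<otimes> bs_normal a b (Suc i) m j = bs_normal a b i m j"
    and "inv b \<otimes> bs_normal a b 0 m j = bs_normal a b 0 (2 * m) (Suc j)"
proof -
  have "a [^] n \<otimes> bs_normal a b i m j = (a [^] n \<otimes> b [^] i) \<otimes> a [^] m \<otimes> inv b [^] j"
    using a b by (simp add: bs_normal_def m_assoc)
  also have "\<dots> = b [^] i \<otimes> (a [^] (2 ^ i * n) \<otimes> a [^] m) \<otimes> inv b [^] j"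
    using a b by (simp add: int_pow_doubling_nat_pow[OF a b rel] m_assoc)
  finally show "a [^] n \<otimes> bs_normal a b i m j = bs_normal a b i (2 ^ i * n + m) j"
    using a by (simp add: bs_normal_def int_pow_mult)
  have Suc: "b [^] Suc i = b \<otimes> b [^] i" using b by (rule nat_pow_Suc2)
  show "b \<otimes> bs_normal a b i m j = bs_normal a b (Suc i) m j"
    unfolding bs_normal_def Suc using a b by (simp add: m_assoc)
  show "inv b \<otimes> bs_normal a b (Suc i) m j = bs_normal a b i m j"
    unfolding bs_normal_def Suc using a b by (simp add: m_assoc inv_solve_left')
  have "inv b \<otimes> (a [^] m \<otimes> b) = a [^] (2 * m)"
    using int_pow_doubling[OF a b rel, of m] a b by (simp add: inv_solve_left')
  then have "inv b \<otimes> a [^] m = a [^] (2 * m) \<otimes> inv b"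
    using a b by (simp add: inv_solve_right m_assoc)
  moreover have "inv b [^] Suc j = inv b \<otimes> inv b [^] j" using b by (intro nat_pow_Suc2) simp
  ultimately show "inv b \<otimes> bs_normal a b 0 m j = bs_normal a b 0 (2 * m) (Suc j)"
    unfolding bs_normal_def using a b by (simp add: m_assoc[symmetric])
qed

end

text \<open>
  Computing the affine map together with the normal form shows that the normal form of the identity
  map has \<open>m = 0\<close> and \<open>i = j\<close>. This makes the embedding injective.
\<close>

lemma bs_word_normal:
  fixes g :: "bs_gen \<Rightarrow> bs_gen gword set"
  defines "g \<equiv> \<lambda>x. word_class bs_relation [(True, x)]"
  shows "\<exists>i m j. word_class bs_relation w = group.bs_normal BS_1_2 (g Gen_a) (g Gen_b) i m j
    \<and> word_value w = Aff (int i - int j) (2 powi (- int j) * real_of_int m)"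
proof -
  interpret group BS_1_2 unfolding BS_1_2_def by (rule group_presented_group)
  have mult: "word_class bs_relation u \<otimes>\<^bsub>BS_1_2\<^esub> word_class bs_relation v
      = word_class bs_relation (u @ v)" for u v
    unfolding BS_1_2_def by (rule presented_group_mult)
  have one: "\<one>\<^bsub>BS_1_2\<^esub> = word_class bs_relation []"
    unfolding BS_1_2_def by (rule presented_group_one)
  have mem: "word_class bs_relation u \<in> carrier BS_1_2" for u
    unfolding BS_1_2_def by (simp add: presented_group_carrier)
  let ?a = "g Gen_a" and ?b = "g Gen_b"
  have g: "g x \<in> carrier BS_1_2" for x unfolding g_def by (rule mem)
  have pos: "word_class bs_relation [(True, x)] = g x" for x by (simp add: g_def)
  have word_inv: "word_class bs_relation [(False, x)] = inv\<^bsub>BS_1_2\<^esub> g x" for x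
  proof (rule inv_equality[symmetric])
    show "word_class bs_relation [(False, x)] \<otimes>\<^bsub>BS_1_2\<^esub> g x = \<one>\<^bsub>BS_1_2\<^esub>"
      using word_eq.cancel[of bs_relation "[]" False x "[]"]
      by (simp add: g_def mult one word_class_eq_iff)
  qed (auto simp: g mem)
  have "word_eq bs_relation ([] @ [(False, Gen_b), (True, Gen_a), (True, Gen_b)] @ [])
      ([] @ [(True, Gen_a), (True, Gen_a)] @ [])"
    by (rule word_eq.relation) simp
  then have rel: "inv\<^bsub>BS_1_2\<^esub> ?b \<otimes>\<^bsub>BS_1_2\<^esub> ?a \<otimes>\<^bsub>BS_1_2\<^esub> ?b = ?a \<otimes>\<^bsub>BS_1_2\<^esub> ?a"
    by (simp add: word_inv[unfolded g_def, symmetric] mult g_def word_class_eq_iff)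
  note step = bs_normal_mult[OF g g rel]
  show ?thesis
  proof (induction w)
    case Nil
    have "word_class bs_relation [] = bs_normal ?a ?b 0 0 0"
      by (simp add: bs_normal_def one[symmetric])
    moreover have "word_value [] = Aff (int 0 - int 0) (2 powi (- int 0) * real_of_int 0)"
      by (simp add: word_value_def one_aff_def)
    ultimately show ?case by blast
  next
    case (Cons l w)
    then obtain i m j where w: "word_class bs_relation w = bs_normal ?a ?b i m j"
      and v: "word_value w = Aff (int i - int j) (2 powi (- int j) * real_of_int m)" by blast
    have cons: "word_class bs_relation (l # w)
        = word_class bs_relation [l] \<otimes>\<^bsub>BS_1_2\<^esub> bs_normal ?a ?b i m j"
      using mult[of "[l]" w] w by simp
    have val: "word_value (l # w)
        = letter_value l * Aff (int i - int j) (2 powi (- int j) * real_of_int m)"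
      using v by (simp add: word_value_def)
    obtain s x where l: "l = (s, x)" by (cases l)
    have p: "(2::real) powi (int i - int j) = 2 ^ i * 2 powi (- int j)"
      using power_int_add[of "2::real" "int i" "- int j"] by simp
    show ?case
    proof (cases x)
      case Gen_a
      define n :: int where "n = (if s then 1 else - 1)"
      have "word_class bs_relation [l] = ?a [^]\<^bsub>BS_1_2\<^esub> n"
        using g[of Gen_a] by (simp add: l Gen_a n_def int_pow_neg word_inv pos)
      then have "word_class bs_relation (l # w) = bs_normal ?a ?b i (2 ^ i * n + m) j"
        using cons step(1) by simp
      moreover have "word_value (l # w)
          = Aff (int i - int j) (2 powi (- int j) * real_of_int (2 ^ i * n + m))"
        using p unfolding val by (simp add: l Gen_a times_aff_def n_def algebra_simps)
      ultimately show ?thesis by blast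
    next
      case Gen_b
      show ?thesis
      proof (cases s)
        case True
        then have "word_class bs_relation (l # w) = bs_normal ?a ?b (Suc i) m j"
          using cons step(2) by (simp add: l Gen_b g_def)
        moreover have "word_value (l # w) = Aff (int (Suc i) - int j) (2 powi (- int j) * real_of_int m)"
          using True unfolding val by (simp add: l Gen_b times_aff_def )
        ultimately show ?thesis by blast
      next
        case False
        then have c: "word_class bs_relation (l # w) = inv\<^bsub>BS_1_2\<^esub> ?b \<otimes>\<^bsub>BS_1_2\<^esub> bs_normal ?a ?b i m j"
          using cons word_inv[of Gen_b] by (simp add: l Gen_b)
        show ?thesis
        proof (cases i)
          case 0
          then have "word_class bs_relation (l # w) = bs_normal ?a ?b 0 (2 * m) (Suc j)"
            using c step(4) by simp
          moreover have "word_value (l # w)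
              = Aff (int 0 - int (Suc j)) (2 powi (- int (Suc j)) * real_of_int (2 * m))"
          proof -
            have "(2::real) powi (- int (Suc j)) * 2 = 2 powi (- int j)"
              using power_int_add[of "2::real" "- int (Suc j)" 1] by simp
            then show ?thesis using False 0 unfolding val by (simp add: l Gen_b times_aff_def algebra_simps)
          qed
          ultimately show ?thesis by blast
        next
          case (Suc k)
          then have "word_class bs_relation (l # w) = bs_normal ?a ?b k m j"
            using c step(3) by simp
          moreover have "word_value (l # w) = Aff (int k - int j) (2 powi (- int j) * real_of_int m)"
            using False Suc unfolding val by (simp add: l Gen_b times_aff_def )
          ultimately show ?thesis by blast
        qed
      qed
    qed
  qed
qed

lemma BS_1_2_embedding:
  obtains h :: "bs_gen gword set \<Rightarrow> aff"
  where "\<forall>A\<in>carrier BS_1_2. \<forall>B\<in>carrier BS_1_2. h (A \<otimes>\<^bsub>BS_1_2\<^esub> B) = h A * h B"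
    and "inj_on h (carrier BS_1_2)"
    and "Aff 0 1 \<in> h ` carrier BS_1_2" and "Aff 1 0 \<in> h ` carrier BS_1_2"
proof -
  interpret group BS_1_2 unfolding BS_1_2_def by (rule group_presented_group)
  define h where "h A = word_value (SOME u. A = word_class bs_relation u)" for A
  have h: "h (word_class bs_relation u) = word_value u" for u
  proof -
    have "word_class bs_relation u = word_class bs_relation (SOME v. word_class bs_relation u = word_class bs_relation v)"
      by (rule someI) (rule HOL.refl)
    then show ?thesis
      unfolding h_def by (metis word_class_eq_iff word_value_cong)
  qed
  have carrier: "carrier BS_1_2 = range (word_class bs_relation)"
    unfolding BS_1_2_def by (rule presented_group_carrier)
  have mult: "word_class bs_relation u \<otimes>\<^bsub>BS_1_2\<^esub> word_class bs_relation v
      = word_class bs_relation (u @ v)" for u v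
    unfolding BS_1_2_def by (rule presented_group_mult)
  let ?a = "word_class bs_relation [(True, Gen_a)]" and ?b = "word_class bs_relation [(True, Gen_b)]"
  show thesis
  proof (rule that[of h])
    have hom: "h (A \<otimes>\<^bsub>BS_1_2\<^esub> B) = h A * h B" if "A \<in> carrier BS_1_2" "B \<in> carrier BS_1_2" for A B
      using that by (auto simp: carrier mult h word_value_append)
    then show "\<forall>A\<in>carrier BS_1_2. \<forall>B\<in>carrier BS_1_2. h (A \<otimes>\<^bsub>BS_1_2\<^esub> B) = h A * h B"
      by blast
    have h1: "h \<one>\<^bsub>BS_1_2\<^esub> = 1"
      using h[of "[]"] by (simp add: BS_1_2_def presented_group_one word_value_def)
    have triv: "A = \<one>\<^bsub>BS_1_2\<^esub>" if "A \<in> carrier BS_1_2" and "h A = 1" for A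
    proof -
      obtain w where w: "A = word_class bs_relation w" using \<open>A \<in> _\<close> carrier by auto
      obtain i m j where A: "A = bs_normal ?a ?b i m j"
        and "word_value w = Aff (int i - int j) (2 powi (- int j) * real_of_int m)"
        using bs_word_normal[of w] w by blast
      then have "i = j" "m = 0" using that(2) h[of w] w by (auto simp: one_aff_def)
      moreover have "?b \<in> carrier BS_1_2" by (simp add: carrier)
      ultimately show ?thesis by (simp add: A bs_normal_def nat_pow_inv)
    qed
    show "inj_on h (carrier BS_1_2)"
    proof (rule inj_onI)
      fix A B assume AB: "A \<in> carrier BS_1_2" "B \<in> carrier BS_1_2" and eq: "h A = h B"
      have "h (A \<otimes>\<^bsub>BS_1_2\<^esub> inv\<^bsub>BS_1_2\<^esub> B) = h (B \<otimes>\<^bsub>BS_1_2\<^esub> inv\<^bsub>BS_1_2\<^esub> B)"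
        using AB eq by (simp only: hom inv_closed)
      then have "A \<otimes>\<^bsub>BS_1_2\<^esub> inv\<^bsub>BS_1_2\<^esub> B = \<one>\<^bsub>BS_1_2\<^esub>"
        using AB h1 by (intro triv) auto
      then show "A = B" using AB by (metis inv_closed inv_equality inv_inv)
    qed
    have "h ?a = Aff 0 1" "h ?b = Aff 1 0" by (simp_all add: h word_value_def)
    then show "Aff 0 1 \<in> h ` carrier BS_1_2" "Aff 1 0 \<in> h ` carrier BS_1_2"
      by (metis carrier image_eqI rangeI)+
  qed
qed

section \<open>Transfer to ordered groups isomorphic to BS(1,2)\<close>

lemma geometric_reverse:
  fixes x c d :: "'a::monoid_mult"
  assumes "c * d = 1"
  shows "geometric (x * c ^ (n - 1)) d n = geometric x c n"
proof -
  have step: "x * c ^ (n - 1) * d ^ i = x * c ^ (n - 1 - i)" if "i < n" for i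
  proof -
    have "c ^ (n - 1) = c ^ (n - 1 - i) * c ^ i" using that by (simp flip: power_add)
    then show ?thesis using left_right_inverse_power[OF assms, of i] by (simp add: mult.assoc)
  qed
  have "geometric (x * c ^ (n - 1)) d n = (\<lambda>i. x * c ^ (n - 1 - i)) ` {..<n}"
    unfolding geometric_def using step by (intro image_cong) auto
  also have "\<dots> = geometric x c n"
    unfolding geometric_def
  proof (intro equalityI subsetI)
    fix v assume "v \<in> (\<lambda>i. x * c ^ i) ` {..<n}"
    then obtain i where "i < n" "v = x * c ^ i" by auto
    then show "v \<in> (\<lambda>i. x * c ^ (n - 1 - i)) ` {..<n}"
      by (intro image_eqI[of _ _ "n - 1 - i"]) auto
  qed auto
  finally show ?thesis .
qed

lemma doubled_by_reverse:
  assumes "c \<noteq> 1" "doubled_by x c"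
  shows "aff_inv c \<noteq> 1" "doubled_by (x * c ^ n) (aff_inv c)"
proof -
  show ne: "aff_inv c \<noteq> 1"
  proof
    assume "aff_inv c = 1"
    then show False using aff_inv_left[of c] assms(1) by simp
  qed
  have "ht (c ^ n) = 0" if "ht c = 0" using that by (induction n) simp_all
  then show "doubled_by (x * c ^ n) (aff_inv c)"
    using assms by (simp add: doubled_by_aff_iff ne)
qed

locale aff_embedding = group G for G :: "('a, 'm) monoid_scheme" (structure) +
  fixes h :: "'a \<Rightarrow> aff"
  assumes h_mult: "\<lbrakk>x \<in> carrier G; y \<in> carrier G\<rbrakk> \<Longrightarrow> h (x \<otimes> y) = h x * h y"
    and inj: "inj_on h (carrier G)"
begin

lemma h_eq_iff: "\<lbrakk>x \<in> carrier G; y \<in> carrier G\<rbrakk> \<Longrightarrow> h x = h y \<longleftrightarrow> x = y"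
  using inj by (rule inj_on_eq_iff)

lemma h_one: "h \<one> = 1"
  using h_mult[of \<one> \<one>] left_cancel[of "h \<one>" "h \<one>" 1] by simp

lemma h_inv:
  assumes "x \<in> carrier G"
  shows "h (inv x) = aff_inv (h x)"
proof -
  have "h x * h (inv x) = h x * aff_inv (h x)"
    using assms h_mult[of x "inv x"] by (simp add: h_one)
  then show ?thesis by (rule left_cancel[THEN iffD1])
qed

lemma h_pow: "x \<in> carrier G \<Longrightarrow> h (x [^] (n::nat)) = h x ^ n"
  by (induction n) (simp_all add: h_one h_mult power_commutes)

lemma doubled_by_iff:
  assumes "c \<in> carrier G" "x \<in> carrier G"
  shows "group_conj G c x = c [^] (2::nat) \<or> group_conj G (c [^] (2::nat)) x = c
    \<longleftrightarrow> doubled_by (h x) (h c)"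
proof -
  have conj: "group_conj G c x = d \<longleftrightarrow> h c * h x = h x * h d"
    if "c \<in> carrier G" "d \<in> carrier G" for c d
  proof -
    have "group_conj G c x = d \<longleftrightarrow> c \<otimes> x = x \<otimes> d"
      using that assms by (simp add: group_conj_def m_assoc inv_solve_left')
    also have "\<dots> \<longleftrightarrow> h (c \<otimes> x) = h (x \<otimes> d)" using that assms by (simp add: h_eq_iff)
    finally show ?thesis using that assms by (simp add: h_mult)
  qed
  show ?thesis using assms by (simp add: conj doubled_by_def h_pow)
qed

lemma card_set_mult:
  assumes "S \<subseteq> carrier G"
  shows "card (S <#> S) = card (h ` S * h ` S)"
proof -
  have "h ` (S <#> S) = h ` S * h ` S"
  proof (intro equalityI subsetI)
    fix v assume "v \<in> h ` (S <#> S)"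
    then obtain x y where xy: "x \<in> S" "y \<in> S" "v = h (x \<otimes> y)" by (auto simp: set_mult_def)
    then have "v = h x * h y" using assms h_mult[of x y] by blast
    then show "v \<in> h ` S * h ` S" using xy by (simp add: set_times_intro)
  next
    fix v assume "v \<in> h ` S * h ` S"
    then obtain x y where xy: "x \<in> S" "y \<in> S" "v = h x * h y" by (auto elim!: set_times_elim)
    moreover have "h (x \<otimes> y) = h x * h y" using assms xy(1,2) by (intro h_mult) auto
    ultimately have "v = h (x \<otimes> y)" by simp
    then show "v \<in> h ` (S <#> S)" using xy by (auto simp: set_mult_def)
  qed
  moreover have "inj_on h (S <#> S)"
    using inj set_mult_closed[OF assms assms] by (rule inj_on_subset)
  ultimately show ?thesis by (metis card_image)
qed

lemma h_geometric:
  assumes "x \<in> carrier G" "c \<in> carrier G"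
  shows "h ` {x \<otimes> c [^] i | i :: nat. i < n} = geometric (h x) (h c) n"
proof -
  have "{x \<otimes> c [^] i | i :: nat. i < n} = (\<lambda>i. x \<otimes> c [^] i) ` {..<n}" by auto
  then show ?thesis
    using assms by (simp add: geometric_def image_image h_mult h_pow)
qed

text \<open>
  The ratio of the first two terms lies in the image of \<open>G\<close>, although \<open>c\<close> is a priori only some affine map.
\<close>

lemma lift_geometric:
  assumes S: "S \<subseteq> carrier G" and n: "2 \<le> n" and eq: "h ` S = geometric x c n"
  obtains x' c' where "x' \<in> carrier G" "c' \<in> carrier G" "h x' = x" "h c' = c"
    "S = {x' \<otimes> c' [^] i | i :: nat. i < n}"
proof -
  have "x * c ^ 0 \<in> h ` S" "x * c ^ 1 \<in> h ` S"
    unfolding eq geometric_def by (rule imageI, use n in simp)+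
  then obtain x' y where xy: "x' \<in> S" "y \<in> S" "h x' = x" "h y = x * c" by auto
  then have G: "x' \<in> carrier G" "y \<in> carrier G" using S by auto
  define c' where "c' = inv x' \<otimes> y"
  have c': "c' \<in> carrier G" using G by (simp add: c'_def)
  have "h x' * h c' = h y" using G c' by (simp add: c'_def flip: h_mult m_assoc)
  then have hc: "h c' = c" using xy by (simp add: left_cancel)
  have "h ` S = h ` {x' \<otimes> c' [^] i | i :: nat. i < n}"
    using eq xy hc by (simp add: h_geometric[OF G(1) c'])
  moreover have "{x' \<otimes> c' [^] i | i :: nat. i < n} \<subseteq> carrier G" using G c' by auto
  ultimately have "S = {x' \<otimes> c' [^] i | i :: nat. i < n}"
    using inj_on_image_eq_iff[OF inj S] by blast
  then show thesis using that G(1) c' xy(3) hc by blast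
qed

text \<open>
  Reading the progression backwards replaces \<open>c\<close> by its inverse and \<open>x\<close> by \<open>x c\<^sup>n\<^sup>-\<^sup>1\<close>, which acts on
  \<open>c\<close> as \<open>x\<close> does. So \<open>c > 1\<close> can always be arranged.
\<close>

lemma geometric_iff:
  fixes le :: "('a \<times> 'a) set"
  assumes le: "ordered_group G le" and S: "S \<subseteq> carrier G" and n: "2 \<le> n"
  shows "(\<exists>x c. h ` S = geometric x c n \<and> c \<noteq> 1 \<and> doubled_by x c) \<longleftrightarrow>
    (\<exists>x \<in> carrier G. \<exists>c \<in> carrier G. S = {x \<otimes> c [^] i | i :: nat. i < n} \<and>
      (\<one>, c) \<in> le \<and> c \<noteq> \<one> \<and>
      (group_conj G c x = c [^] (2::nat) \<or> group_conj G (c [^] (2::nat)) x = c))"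
    (is "?L \<longleftrightarrow> ?R")
proof
  interpret ordered_group G le by (rule le)
  assume ?L
  then obtain x c where eq: "h ` S = geometric x c n" and c: "c \<noteq> 1" "doubled_by x c" by blast
  obtain x1 c1 where 1: "x1 \<in> carrier G" "c1 \<in> carrier G" "h x1 = x" "h c1 = c"
    "S = {x1 \<otimes> c1 [^] i | i :: nat. i < n}"
    using lift_geometric[OF S n eq] by blast
  have "c1 \<noteq> \<one>" using 1(4) c(1) h_one by auto
  show ?R
  proof (cases "(\<one>, c1) \<in> le")
    case True
    then show ?thesis using 1 c \<open>c1 \<noteq> \<one>\<close> doubled_by_iff[of c1 x1] by blast
  next
    case False
    then have "(c1, \<one>) \<in> le"
      using linear_order 1(2) \<open>c1 \<noteq> \<one>\<close> by (auto simp: linear_order_on_def total_on_def)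
    have eq': "h ` S = geometric (x * c ^ (n - 1)) (aff_inv c) n"
      using eq geometric_reverse[OF aff_inv_right] by metis
    obtain x2 c2 where 2: "x2 \<in> carrier G" "c2 \<in> carrier G" "h x2 = x * c ^ (n - 1)"
      "h c2 = aff_inv c" "S = {x2 \<otimes> c2 [^] i | i :: nat. i < n}"
      using lift_geometric[OF S n eq'] by blast
    have "c2 = inv c1" using 1 2 by (simp add: h_inv flip: h_eq_iff)
    then have "(\<one>, c2) \<in> le"
      using translate[of c1 \<one> "inv c1" \<one>] \<open>(c1, \<one>) \<in> le\<close> 1(2) by simp
    moreover have "c2 \<noteq> \<one>" using \<open>c2 = inv c1\<close> \<open>c1 \<noteq> \<one>\<close> 1(2) by (simp add: inv_eq_1_iff)
    moreover have "doubled_by (h x2) (h c2)" using 2 doubled_by_reverse(2)[OF c] by simp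
    ultimately show ?thesis using 2 doubled_by_iff[of c2 x2] by blast
  qed
next
  assume ?R
  then obtain x c where xc: "x \<in> carrier G" "c \<in> carrier G" "c \<noteq> \<one>"
    and Seq: "S = {x \<otimes> c [^] i | i :: nat. i < n}"
    and dbl: "group_conj G c x = c [^] (2::nat) \<or> group_conj G (c [^] (2::nat)) x = c" by blast
  have "h ` S = geometric (h x) (h c) n" unfolding Seq by (rule h_geometric[OF xc(1,2)])
  moreover have "h c \<noteq> 1" using xc h_eq_iff[of c \<one>] by (simp add: h_one)
  moreover have "doubled_by (h x) (h c)" using dbl doubled_by_iff[OF xc(2,1)] by blast
  ultimately show ?L by blast
qed

lemma exceptional_iff:
  assumes S: "S \<subseteq> carrier G"
  shows "(\<exists>x c. h ` S = {1, c, c ^ 2, x} \<and> doubled_by x c) \<longleftrightarrow>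
    (\<exists>x \<in> carrier G. \<exists>c \<in> carrier G. S = {\<one>, c, c [^] (2::nat), x} \<and>
      (group_conj G c x = c [^] (2::nat) \<or> group_conj G (c [^] (2::nat)) x = c))"
    (is "?L \<longleftrightarrow> ?R")
proof -
  have image: "h ` {\<one>, c, c [^] (2::nat), x} = {1, h c, h c ^ 2, h x}" if "c \<in> carrier G" for c x
    using that by (simp add: h_one h_pow)
  show ?thesis
  proof
    assume ?L
    then obtain x c where eq: "h ` S = {1, c, c ^ 2, x}" and dbl: "doubled_by x c" by blast
    have "x \<in> h ` S" "c \<in> h ` S" unfolding eq by auto
    then obtain x' c' where xc: "x' \<in> S" "c' \<in> S" "h x' = x" "h c' = c" by blast
    then have G: "x' \<in> carrier G" "c' \<in> carrier G" using S by auto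
    have "h ` S = h ` {\<one>, c', c' [^] (2::nat), x'}"
      unfolding image[OF G(2)] using eq xc by simp
    moreover have "{\<one>, c', c' [^] (2::nat), x'} \<subseteq> carrier G" using G by auto
    ultimately have "S = {\<one>, c', c' [^] (2::nat), x'}"
      using inj_on_image_eq_iff[OF inj S] by blast
    then show ?R using dbl xc G doubled_by_iff[OF G(2,1)] by blast
  next
    assume ?R
    then obtain x c where xc: "x \<in> carrier G" "c \<in> carrier G"
      and Seq: "S = {\<one>, c, c [^] (2::nat), x}"
      and dbl: "group_conj G c x = c [^] (2::nat) \<or> group_conj G (c [^] (2::nat)) x = c" by blast
    have "h ` S = {1, h c, h c ^ 2, h x}" unfolding Seq by (rule image[OF xc(2)])
    moreover have "doubled_by (h x) (h c)" using dbl doubled_by_iff[OF xc(2,1)] by blast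
    ultimately show ?L by blast
  qed
qed

lemma generate_in_subgroup:
  assumes "generate G S = carrier G" and "\<And>s. s \<in> S \<Longrightarrow> s \<in> H" and "subgroup H G"
    and "v \<in> h ` carrier G"
  shows "v \<in> h ` H"
proof -
  have "carrier G \<subseteq> H"
    using generate_subgroup_incl[OF _ assms(3), of S] assms(1,2) by auto
  then show ?thesis using assms(4) by blast
qed

lemma subgroup_ht_dvd: "subgroup {g \<in> carrier G. m dvd ht (h g)} G"
  by (rule subgroupI) (auto simp: h_mult h_inv h_one intro!: exI[of _ \<one>])

lemma subgroup_commute: "subgroup {g \<in> carrier G. x * h g = h g * x} G"
proof (rule subgroupI)
  fix g assume "g \<in> {g \<in> carrier G. x * h g = h g * x}"
  then have g: "g \<in> carrier G" "x * h g = h g * x" by auto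
  let ?y = "h g" and ?z = "aff_inv (h g)"
  have "?y * (x * ?z) = x * ?y * ?z" unfolding g(2) by (rule mult.assoc[symmetric])
  also have "\<dots> = ?y * (?z * x)" by (simp add: mult.assoc) (simp flip: mult.assoc)
  finally show "inv g \<in> {g \<in> carrier G. x * h g = h g * x}"
    using g by (simp add: h_inv left_cancel)
qed (auto simp: h_one h_mult commute_mult intro!: exI[of _ \<one>])

text \<open>
  The elements whose height is divisible by \<open>m\<close> form a subgroup, and the image of \<open>b\<close> has height 1.
\<close>

lemma generators_ht:
  assumes "generate G S = carrier G" "Aff 1 0 \<in> h ` carrier G" "S \<subseteq> carrier G"
    and "\<And>s. s \<in> h ` S \<Longrightarrow> m dvd ht s"
  shows "\<bar>m\<bar> = 1"
proof -
  have "Aff 1 0 \<in> h ` {g \<in> carrier G. m dvd ht (h g)}"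
  proof (rule generate_in_subgroup[OF assms(1) _ subgroup_ht_dvd assms(2)])
    show "s \<in> {g \<in> carrier G. m dvd ht (h g)}" if "s \<in> S" for s
      using that assms(3) assms(4)[of "h s"] by auto
  qed
  then obtain g where "m dvd ht (h g)" "Aff 1 0 = h g" by blast
  then have "m dvd 1" by (metis aff.sel(1))
  then show ?thesis by simp
qed

text \<open>
  Some generator \<open>x\<close> has nonzero height. If the generators commute, then \<open>x\<close> is central, but the
  nontrivial translation \<open>Aff 0 1\<close> does not commute with \<open>x\<close>.
\<close>

lemma generators_noncommuting:
  assumes gen: "generate G S = carrier G" and S: "S \<subseteq> carrier G"
    and one: "Aff 1 0 \<in> h ` carrier G" "Aff 0 1 \<in> h ` carrier G"
  shows "\<not> pairwise_commuting (h ` S)"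
proof
  assume com: "pairwise_commuting (h ` S)"
  obtain x where x: "x \<in> h ` S" "ht x \<noteq> 0"
    using generators_ht[OF gen one(1) S, of 0] by auto
  have "Aff 0 1 \<in> h ` {g \<in> carrier G. x * h g = h g * x}"
  proof (rule generate_in_subgroup[OF gen _ subgroup_commute one(2)])
    show "s \<in> {g \<in> carrier G. x * h g = h g * x}" if "s \<in> S" for s
      using that S com x(1) by (auto simp: pairwise_commuting_def)
  qed
  then obtain g where "x * h g = h g * x" "Aff 0 1 = h g" by blast
  then have "x * Aff 0 1 = Aff 0 1 * x" by simp
  then have "Aff 0 1 = 1" using commute_same_ht[OF x(2), of "Aff 0 1" 1] by simp
  then show False by (simp add: one_aff_def)
qed

end

theorem theorem3:
  fixes G :: "('g, 'm) monoid_scheme" (structure)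
    and le :: "('g \<times> 'g) set"
    and S :: "'g set"
  assumes "ordered_group G le"
    and "G \<cong> BS_1_2"
    and "S \<subseteq> carrier G" and "finite S" and "generate G S = carrier G"
  shows "(\<forall>k. card S = k \<and> k > 4 \<longrightarrow>
      (card (S <#> S) = 3 * card S - 2 \<longleftrightarrow>
        (\<exists>x \<in> carrier G. \<exists>c \<in> carrier G.
          S = {x \<otimes> c [^] i | i :: nat. i < k} \<and>
          (\<one>, c) \<in> le \<and> c \<noteq> \<one> \<and>
          (group_conj G c x = c [^] (2::nat) \<or> group_conj G (c [^] (2::nat)) x = c))))
    \<and>
    (card S = 4 \<longrightarrow>
      (card (S <#> S) = 3 * card S - 2 \<longleftrightarrow>
        (\<exists>x \<in> carrier G. \<exists>c \<in> carrier G.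
          (S = {\<one>, c, c [^] (2::nat), x} \<and>
            (group_conj G c x = c [^] (2::nat) \<or> group_conj G (c [^] (2::nat)) x = c))
          \<or>
          (S = {x, x \<otimes> c, x \<otimes> c [^] (2::nat), x \<otimes> c [^] (3::nat)} \<and>
            (\<one>, c) \<in> le \<and> c \<noteq> \<one> \<and>
            (group_conj G c x = c [^] (2::nat) \<or> group_conj G (c [^] (2::nat)) x = c)))))"
proof -
  interpret ordered_group G le by (rule assms(1))
  obtain f where f: "f \<in> iso G BS_1_2" using assms(2) by (auto simp: is_iso_def)
  obtain h0 where h0:
    "\<forall>A\<in>carrier BS_1_2. \<forall>B\<in>carrier BS_1_2. h0 (A \<otimes>\<^bsub>BS_1_2\<^esub> B) = h0 A * h0 B"
    "inj_on h0 (carrier BS_1_2)"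
    "Aff 0 1 \<in> h0 ` carrier BS_1_2" "Aff 1 0 \<in> h0 ` carrier BS_1_2"
    by (rule BS_1_2_embedding)
  define h where "h = h0 \<circ> f"
  have bij: "bij_betw f (carrier G) (carrier BS_1_2)" and hom: "f \<in> hom G BS_1_2"
    using f by (auto simp: iso_def)
  have img: "h ` carrier G = h0 ` carrier BS_1_2"
    unfolding h_def image_comp[symmetric] bij_betw_imp_surj_on[OF bij] ..
  interpret aff_embedding G h
  proof
    show "h (x \<otimes> y) = h x * h y" if "x \<in> carrier G" "y \<in> carrier G" for x y
      using that hom_in_carrier[OF hom] by (simp add: h_def hom_mult[OF hom] h0(1))
    show "inj_on h (carrier G)"
      unfolding h_def using bij h0(2) by (metis bij_betw_def comp_inj_on)
  qed
  have card: "card (h ` S) = card S" using inj assms(3) by (metis card_image inj_on_subset)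
  have main: "card (S <#> S) = 3 * card S - 2 \<longleftrightarrow>
      (\<exists>x c. h ` S = geometric x c (card S) \<and> c \<noteq> 1 \<and> doubled_by x c) \<or>
      card S = 4 \<and> (\<exists>x c. h ` S = {1, c, c ^ 2, x} \<and> doubled_by x c)" if "4 \<le> card S"
  proof -
    have "\<not> pairwise_commuting (h ` S)"
      using generators_noncommuting[OF assms(5,3)] h0(3,4) img by simp
    moreover have "\<bar>m\<bar> = 1" if "\<And>s. s \<in> h ` S \<Longrightarrow> m dvd ht s" for m
      using generators_ht[OF assms(5) _ assms(3) that] h0(4) img by simp
    ultimately show ?thesis
      using small_doubling_aff[of "h ` S"] assms(4) that
      unfolding card card_set_mult[OF assms(3)] by blast
  qed
  have four: "{x \<otimes> c [^] i | i :: nat. i < 4}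
      = {x, x \<otimes> c, x \<otimes> c [^] (2::nat), x \<otimes> c [^] (3::nat)}"
    if "x \<in> carrier G" "c \<in> carrier G" for x c
  proof -
    have "{x \<otimes> c [^] i | i :: nat. i < 4} = (\<lambda>i. x \<otimes> c [^] i) ` {..<4 :: nat}" by blast
    also have "{..<4::nat} = {0, 1, 2, 3}" by auto
    finally show ?thesis using that by simp
  qed
  note geo = geometric_iff[OF assms(1,3)]
  show ?thesis
  proof (intro conjI allI impI)
    fix k assume k: "card S = k \<and> k > 4"
    then have "2 \<le> k" "4 \<le> card S" "card S \<noteq> 4" "card S = k" by auto
    then show "card (S <#> S) = 3 * card S - 2 \<longleftrightarrow>
        (\<exists>x \<in> carrier G. \<exists>c \<in> carrier G.
          S = {x \<otimes> c [^] i | i :: nat. i < k} \<and>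
          (\<one>, c) \<in> le \<and> c \<noteq> \<one> \<and>
          (group_conj G c x = c [^] (2::nat) \<or> group_conj G (c [^] (2::nat)) x = c))"
      using main geo[of k] by simp
  next
    assume S4: "card S = 4"
    have geo4: "(\<exists>x c. h ` S = geometric x c 4 \<and> c \<noteq> 1 \<and> doubled_by x c) \<longleftrightarrow>
        (\<exists>x \<in> carrier G. \<exists>c \<in> carrier G.
          S = {x, x \<otimes> c, x \<otimes> c [^] (2::nat), x \<otimes> c [^] (3::nat)} \<and>
          (\<one>, c) \<in> le \<and> c \<noteq> \<one> \<and>
          (group_conj G c x = c [^] (2::nat) \<or> group_conj G (c [^] (2::nat)) x = c))"
      unfolding geo[of 4, simplified] by (intro bex_cong HOL.refl) (simp only: four)
    have "card (S <#> S) = 3 * card S - 2 \<longleftrightarrow>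
        (\<exists>x c. h ` S = geometric x c 4 \<and> c \<noteq> 1 \<and> doubled_by x c) \<or>
        (\<exists>x c. h ` S = {1, c, c ^ 2, x} \<and> doubled_by x c)"
      using main S4 by simp
    also have "\<dots> \<longleftrightarrow> (\<exists>x \<in> carrier G. \<exists>c \<in> carrier G.
          (S = {\<one>, c, c [^] (2::nat), x} \<and>
            (group_conj G c x = c [^] (2::nat) \<or> group_conj G (c [^] (2::nat)) x = c))
          \<or>
          (S = {x, x \<otimes> c, x \<otimes> c [^] (2::nat), x \<otimes> c [^] (3::nat)} \<and>
            (\<one>, c) \<in> le \<and> c \<noteq> \<one> \<and>
            (group_conj G c x = c [^] (2::nat) \<or> group_conj G (c [^] (2::nat)) x = c)))"
      unfolding geo4 exceptional_iff[OF assms(3)] by blast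
    finally show "card (S <#> S) = 3 * card S - 2 \<longleftrightarrow> (\<exists>x \<in> carrier G. \<exists>c \<in> carrier G.
          (S = {\<one>, c, c [^] (2::nat), x} \<and>
            (group_conj G c x = c [^] (2::nat) \<or> group_conj G (c [^] (2::nat)) x = c))
          \<or>
          (S = {x, x \<otimes> c, x \<otimes> c [^] (2::nat), x \<otimes> c [^] (3::nat)} \<and>
            (\<one>, c) \<in> le \<and> c \<noteq> \<one> \<and>
            (group_conj G c x = c [^] (2::nat) \<or> group_conj G (c [^] (2::nat)) x = c)))" .
  qed
qed

end
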